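(* Let $\lambda=(\lambda_1\ge\dots\ge\lambda_n\ge0)$ be a partition and let $\sigma_\lambda$ be the grassmannian permutation of shape $\lambda$ with a unique descent at position $n$. Write $X_n=(x_1,\dots,x_n)$. Then (A) $$\mathfrak{G}^{(\beta)}_{\sigma_\lambda}(X_n)=\det\bigl|h^{(\beta)}_{\lambda_j+i,\,j}(X_n)\bigr|_{1\le i,j\le n}=\frac{\det\bigl|x_i^{\lambda_j+n-j}(1+\beta x_i)^{j-1}\bigr|_{1\le i,j\le n}}{\prod_{1\le i<j\le n}(x_i-x_j)},$$ where for integers $m$, $k\ge1$ and a set of variables $X$ $$h^{(\beta)}_{m,k}(X)=\sum_{a=0}^{k-1}\binom{k-1}{a}h_{m-k+a}(X)\beta^a,$$ and $h_r(X)$ is the complete homogeneous symmetric polynomial of degree $r$ ($h_r=0$ for $r<0$). (B) $$\mathfrak{G}^{(\beta)}_{\sigma_\lambda}(X,Y)=\frac{\det\Bigl|\prod_{a=1}^{\lambda_j+n-j}(x_i+y_a+\beta x_iy_a)\,(1+\beta x_i)^{j-1}\Bigr|_{1\le i,j\le n}}{\prod_{1\le i<j\le n}(x_i-x_j)}.$$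
   Context: The grassmannian permutation $\sigma_\lambda\in\mathbb{S}_N$ ($N$ large) is given by $\sigma_\lambda(i)=i+\lambda_{n+1-i}$ for $1\le i\le n$ and $\sigma_\lambda(n+1)<\sigma_\lambda(n+2)<\cdots$. Let $\beta$ be an indeterminate. $\mathrm{IdC}_N(\beta)$ is the associative $\mathbb{Z}[\beta]$-algebra with generators $e_1,\dots,e_{N-1}$ and relations $e_ie_j=e_je_i$ if $|i-j|\ge2$, $e_ie_je_i=e_je_ie_j$ if $|i-j|=1$, $e_i^2=\beta e_i$. For $w\in\mathbb{S}_N$ put $e_w=e_{i_1}\cdots e_{i_\ell}$ for any reduced word $w=s_{i_1}\cdots s_{i_\ell}$ ($s_i=(i,i+1)$, permutations composed from right to left); the $e_w$ form a $\mathbb{Z}[\beta]$-basis. With commuting variables $x_i,y_i$ commuting with all $e_j$, put $h_i(x)=1+xe_i$, $x\oplus y=x+y+\beta xy$, $A_i(x)=h_{N-1}(x)\cdots h_i(x)$. The $\beta$-Grothendieck polynomials are defined by $A_1(x_1)\cdots A_{N-1}(x_{N-1})=\sum_{w\in\mathbb{S}_N}\mathfrak{G}_w^{(\beta)}(X)e_w$, and the double $\beta$-Grothendieck polynomials by $$\prod_{i=1,2,\dots,N-1}\ \prod_{j=N-i,\dots,1}h_{i+j-1}(x_i\oplus y_j)=\sum_{w\in\mathbb{S}_N}\mathfrak{G}_w^{(\beta)}(X,Y)e_w$$ (factors left to right in the indicated order). They are stable under $\mathbb{S}_N\subset\mathbb{S}_{N+1}$. *)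

theory Defs
  imports
    "HOL-Library.Poly_Mapping"
    "HOL-Library.Multiset"
    "HOL-Combinatorics.Permutations"
    "HOL-Computational_Algebra.Polynomial_Factorial"
    "HOL-Algebra.QuotRing"
    "Jordan_Normal_Form.Determinant"
begin

section \<open>The polynomial ring in the $x_i$ and $y_i$ over $\mathbf{Z}[\beta]$\<close>

datatype var = XVar nat | YVar nat

text \<open>
  The order on variables is arbitrary; it is there only because the library asks for a linear
  order on monomials to make polynomials an integral domain.
\<close>

fun var_key :: "var \<Rightarrow> nat" where
  "var_key (XVar i) = 2 * i"
| "var_key (YVar i) = 2 * i + 1"

lemma var_key_inject: "var_key u = var_key v \<longleftrightarrow> u = v"
  by (cases u; cases v; simp; presburger)

instantiation var :: linorder
begin

definition "u \<le> v \<longleftrightarrow> var_key u \<le> var_key v" for u v :: var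
definition "u < v \<longleftrightarrow> var_key u < var_key v" for u v :: var

instance
  by intro_classes (auto simp: less_eq_var_def less_var_def simp flip: var_key_inject)

end

text \<open>Monomials are finitely supported exponent functions; \<^typ>\<open>int poly\<close> is $\mathbf{Z}[\beta]$.\<close>

type_synonym xy_poly = "(var \<Rightarrow>\<^sub>0 nat) \<Rightarrow>\<^sub>0 int poly"

definition beta :: xy_poly where
  "beta = Poly_Mapping.single 0 [:0, 1:]"

definition xv :: "nat \<Rightarrow> xy_poly" where
  "xv i = Poly_Mapping.single (Poly_Mapping.single (XVar i) 1) 1"

definition yv :: "nat \<Rightarrow> xy_poly" where
  "yv i = Poly_Mapping.single (Poly_Mapping.single (YVar i) 1) 1"


section \<open>The free associative algebra\<close>

text \<open>
  Words under concatenation, written additively: then \<open>fword \<Rightarrow>\<^sub>0 'a\<close> carries the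
  multiplication of the free associative \<open>'a\<close>-algebra on generators indexed by \<^typ>\<open>nat\<close>.
\<close>

datatype fword = FWord (letters: "nat list")

instantiation fword :: monoid_add
begin

definition "0 = FWord []"
definition "u + v = FWord (letters u @ letters v)" for u v :: fword

instance
  by intro_classes (simp_all add: zero_fword_def plus_fword_def)

end

type_synonym 'a free_alg = "fword \<Rightarrow>\<^sub>0 'a"

definition fscalar :: "'a :: comm_ring_1 \<Rightarrow> 'a free_alg" where
  "fscalar c = Poly_Mapping.single 0 c"

definition fgen :: "nat \<Rightarrow> 'a :: comm_ring_1 free_alg" where
  "fgen i = Poly_Mapping.single (FWord [i]) 1"

definition free_algebra :: "nat \<Rightarrow> 'a :: comm_ring_1 free_alg ring" where
  "free_algebra N =
     \<lparr>carrier = {f. \<forall>w \<in> Poly_Mapping.keys f. set (letters w) \<subseteq> {1..<N}},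
      monoid.mult = (*), one = 1, zero = 0, add = (+)\<rparr>"


section \<open>The algebra IdC\<close>

text \<open>
  The coefficient ring \<open>'a\<close> is arbitrary. Over \<^typ>\<open>xy_poly\<close>, with \<open>b\<close> the element \<^term>\<open>beta\<close>,
  this is the extension of scalars of the $\mathbf{Z}[\beta]$-algebra obtained by adjoining the
  central variables $x_i$, $y_i$.
\<close>

definition IdC_relators :: "nat \<Rightarrow> 'a :: comm_ring_1 \<Rightarrow> 'a free_alg set" where
  "IdC_relators N b =
     {fgen i * fgen j - fgen j * fgen i | i j.
        i \<in> {1..<N} \<and> j \<in> {1..<N} \<and> \<bar>int i - int j\<bar> \<ge> 2}
   \<union> {fgen i * fgen j * fgen i - fgen j * fgen i * fgen j | i j.
        i \<in> {1..<N} \<and> j \<in> {1..<N} \<and> \<bar>int i - int j\<bar> = 1}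
   \<union> {fgen i * fgen i - fscalar b * fgen i | i. i \<in> {1..<N}}"

definition IdC_ideal :: "nat \<Rightarrow> 'a :: comm_ring_1 \<Rightarrow> 'a free_alg set" where
  "IdC_ideal N b = Idl\<^bsub>free_algebra N\<^esub> (IdC_relators N b)"

definition IdC :: "nat \<Rightarrow> 'a :: comm_ring_1 \<Rightarrow> 'a free_alg set ring" where
  "IdC N b = free_algebra N Quot IdC_ideal N b"

definition IdC_scalar :: "nat \<Rightarrow> 'a :: comm_ring_1 \<Rightarrow> 'a \<Rightarrow> 'a free_alg set" where
  "IdC_scalar N b c = IdC_ideal N b +>\<^bsub>free_algebra N\<^esub> fscalar c"

definition IdC_gen :: "nat \<Rightarrow> 'a :: comm_ring_1 \<Rightarrow> nat \<Rightarrow> 'a free_alg set" where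
  "IdC_gen N b i = IdC_ideal N b +>\<^bsub>free_algebra N\<^esub> fgen i"

definition IdC_prod :: "nat \<Rightarrow> 'a :: comm_ring_1 \<Rightarrow> 'a free_alg set list \<Rightarrow> 'a free_alg set" where
  "IdC_prod N b us = foldr (\<lambda>u v. u \<otimes>\<^bsub>IdC N b\<^esub> v) us \<one>\<^bsub>IdC N b\<^esub>"


section \<open>Permutations and the elements $e_w$\<close>

definition word_perm :: "nat list \<Rightarrow> nat \<Rightarrow> nat" where
  "word_perm ks = foldr (\<circ>) (map (\<lambda>k. Transposition.transpose k (k + 1)) ks) id"

definition reduced_word :: "nat \<Rightarrow> (nat \<Rightarrow> nat) \<Rightarrow> nat list \<Rightarrow> bool" where
  "reduced_word N w ks \<longleftrightarrow>
     set ks \<subseteq> {1..<N} \<and> word_perm ks = w \<and>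
     (\<forall>ls. set ls \<subseteq> {1..<N} \<and> word_perm ls = w \<longrightarrow> length ks \<le> length ls)"

text \<open>By the braid relations the choice of reduced word does not matter.\<close>

definition IdC_perm :: "nat \<Rightarrow> 'a :: comm_ring_1 \<Rightarrow> (nat \<Rightarrow> nat) \<Rightarrow> 'a free_alg set" where
  "IdC_perm N b w = IdC_prod N b (map (IdC_gen N b) (SOME ks. reduced_word N w ks))"

text \<open>The coordinates of \<open>u\<close> in the basis $(e_w)_{w \in S_N}$.\<close>

definition IdC_coord :: "nat \<Rightarrow> 'a :: comm_ring_1 \<Rightarrow> 'a free_alg set \<Rightarrow> (nat \<Rightarrow> nat) \<Rightarrow> 'a" where
  "IdC_coord N b u =
     (THE c. (\<forall>w. \<not> w permutes {1..N} \<longrightarrow> c w = 0) \<and>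
        u = finsum (IdC N b) (\<lambda>w. IdC_scalar N b (c w) \<otimes>\<^bsub>IdC N b\<^esub> IdC_perm N b w)
              {w. w permutes {1..N}})"


section \<open>Grothendieck polynomials\<close>

definition IdC_h :: "nat \<Rightarrow> 'a :: comm_ring_1 \<Rightarrow> nat \<Rightarrow> 'a \<Rightarrow> 'a free_alg set" where
  "IdC_h N b i t = \<one>\<^bsub>IdC N b\<^esub> \<oplus>\<^bsub>IdC N b\<^esub> (IdC_scalar N b t \<otimes>\<^bsub>IdC N b\<^esub> IdC_gen N b i)"

definition IdC_A :: "nat \<Rightarrow> 'a :: comm_ring_1 \<Rightarrow> nat \<Rightarrow> 'a \<Rightarrow> 'a free_alg set" where
  "IdC_A N b i t = IdC_prod N b (map (\<lambda>k. IdC_h N b k t) (rev [i..<N]))"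

definition fplus :: "'a :: comm_ring_1 \<Rightarrow> 'a \<Rightarrow> 'a \<Rightarrow> 'a" where
  "fplus b s t = s + t + b * s * t"

definition groth :: "nat \<Rightarrow> 'a :: comm_ring_1 \<Rightarrow> (nat \<Rightarrow> 'a) \<Rightarrow> (nat \<Rightarrow> nat) \<Rightarrow> 'a" where
  "groth N b x = IdC_coord N b (IdC_prod N b (map (\<lambda>i. IdC_A N b i (x i)) [1..<N]))"

definition double_groth ::
  "nat \<Rightarrow> 'a :: comm_ring_1 \<Rightarrow> (nat \<Rightarrow> 'a) \<Rightarrow> (nat \<Rightarrow> 'a) \<Rightarrow> (nat \<Rightarrow> nat) \<Rightarrow> 'a" where
  "double_groth N b x y =
     IdC_coord N b
       (IdC_prod N b
         (map (\<lambda>i. IdC_prod N b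
                (map (\<lambda>j. IdC_h N b (i + j - 1) (fplus b (x i) (y j))) (rev [1..<N - i + 1])))
           [1..<N]))"


section \<open>Grassmannian permutations and complete homogeneous polynomials\<close>

text \<open>Exists and is unique when \<open>lam\<close> is weakly decreasing on \<open>{1..n}\<close> and \<open>n + lam 1 \<le> N\<close>.\<close>

definition grassmannian :: "nat \<Rightarrow> nat \<Rightarrow> (nat \<Rightarrow> nat) \<Rightarrow> nat \<Rightarrow> nat" where
  "grassmannian N n lam =
     (THE s. s permutes {1..N} \<and> (\<forall>i\<in>{1..n}. s i = i + lam (n + 1 - i)) \<and>
        strict_mono_on {n + 1..N} s)"

text \<open>The index set of the sum is empty for \<open>r < 0\<close>.\<close>

definition complete_hom :: "nat set \<Rightarrow> (nat \<Rightarrow> 'a :: comm_ring_1) \<Rightarrow> int \<Rightarrow> 'a" where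
  "complete_hom I x r = (\<Sum>M | set_mset M \<subseteq> I \<and> int (size M) = r. \<Prod>i\<in>#M. x i)"

definition beta_complete_hom ::
  "nat set \<Rightarrow> 'a :: comm_ring_1 \<Rightarrow> (nat \<Rightarrow> 'a) \<Rightarrow> int \<Rightarrow> nat \<Rightarrow> 'a" where
  "beta_complete_hom I b x m k =
     (\<Sum>a = 0..k - 1. of_nat ((k - 1) choose a) * complete_hom I x (m - int k + int a) * b ^ a)"

text \<open>Indices of a determinant $\det|f(i,j)|_{1 \le i,j \le n}$ start at 1, those of \<^const>\<open>mat\<close> at 0.\<close>

definition det1 :: "nat \<Rightarrow> (nat \<Rightarrow> nat \<Rightarrow> 'a :: comm_ring_1) \<Rightarrow> 'a" where
  "det1 n f = det (mat n n (\<lambda>(r, c). f (r + 1) (c + 1)))"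

end

theory Submission
  imports Defs
begin

text \<open>
  The algebra IdC acts on the free module on the symmetric group, and $e_w$ applied to the
  identity gives the basis vector of $w$. As the words $[j_{N-1}, \dots, N-1] \cdots [j_1, \dots, 1]$
  span IdC, coordinates in IdC can be read off from this action.

  On the coordinates at Grassmannian permutations, recorded as the set of the first $n$ values, a
  factor $1 + t e_k$ moves a particle from $k$ to $k + 1$ with weight $t$, and multiplies by
  $1 + \beta t$ if $k$ is empty and $k + 1$ is occupied. The inner product for one variable $x_i$
  sweeps all particles to the right, and after the sweep the coordinate is again a quotient
  of determinants: each factor alters at most one column, and at the end of the sweep the new
  columns are what remains of the larger determinant when the row of $x_i$ is cleared.

  The single polynomials are the case $y = 0$. The Jacobi-Trudi determinant is obtained from the
  bialternant by dividing by the matrix of coefficients of the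
  polynomials $\prod_{a \neq i} (1 - x_a t)$, whose determinant is the Vandermonde determinant.
\<close>

section \<open>The action of the free algebra on functions of permutations\<close>

text \<open>Coordinates in IdC are defined through chosen reduced words and a definite description,
  so these data must first be shown to be well defined. Canonical words go to distinct point masses,
  hence are independent as well as spanning. Expanding a chosen reduced word in them and letting
  both sides act on the identity shows that its class is that of one canonical word.

  The determinants come from an induction over the rows of the product, from x_n down to x_1; rows
  of higher index leave the coordinates at Grassmannian permutations alone. The obstacle lies inside
  a row: its partial products break the symmetry between the new variable x and the old variables t,
  and the bialternant shape returns only at the end. The intermediate columns are modelled on that
  end: clearing the row of x in the larger determinant yields the columns of the particles already
  passed, and the others keep their old shape times x - t. Clearing a row costs powers of 1 +
  \<beta> x, so these must be cancellable; all formulas are therefore proved with denominators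
  multiplied out in an integral domain.\<close>

abbreviation adj :: "nat \<Rightarrow> nat \<Rightarrow> nat" where
  "adj k \<equiv> Transposition.transpose k (Suc k)"

text \<open>
  Functions are indexed by inverses of permutations, so that $e_w$ corresponds to the point mass
  at $w^{-1}$ and left multiplication by $e_i$ to the operator below, which makes sense for
  arbitrary functions \<open>p\<close>.
\<close>

definition hecke :: "'a :: comm_ring_1 \<Rightarrow> nat \<Rightarrow> ((nat \<Rightarrow> nat) \<Rightarrow> 'a) \<Rightarrow> (nat \<Rightarrow> nat) \<Rightarrow> 'a" where
  "hecke b i f p = (if p (Suc i) < p i then f (p \<circ> adj i) + b * f p else 0)"

definition word_act :: "'a :: comm_ring_1 \<Rightarrow> nat list \<Rightarrow> ((nat \<Rightarrow> nat) \<Rightarrow> 'a) \<Rightarrow> (nat \<Rightarrow> nat) \<Rightarrow> 'a" where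
  "word_act b ks f = foldr (hecke b) ks f"

definition alg_act :: "'a :: comm_ring_1 \<Rightarrow> 'a free_alg \<Rightarrow> ((nat \<Rightarrow> nat) \<Rightarrow> 'a) \<Rightarrow> (nat \<Rightarrow> nat) \<Rightarrow> 'a" where
  "alg_act b u f p = (\<Sum>w\<in>Poly_Mapping.keys u. Poly_Mapping.lookup u w * word_act b (letters w) f p)"

lemma word_act_Nil [simp]: "word_act b [] f = f"
  by (simp add: word_act_def)

lemma word_act_Cons [simp]: "word_act b (k # ks) f = hecke b k (word_act b ks f)"
  by (simp add: word_act_def)

lemma word_act_append: "word_act b (ks @ ls) f = word_act b ks (word_act b ls f)"
  by (simp add: word_act_def)

lemma hecke_sum: "hecke b i (\<lambda>p. \<Sum>j\<in>J. c j * g j p) = (\<lambda>p. \<Sum>j\<in>J. c j * hecke b i (g j) p)"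
  by (rule ext) (simp add: hecke_def sum_distrib_left sum.distrib [symmetric] algebra_simps)

lemma word_act_sum:
  "word_act b ks (\<lambda>p. \<Sum>j\<in>J. c j * g j p) = (\<lambda>p. \<Sum>j\<in>J. c j * word_act b ks (g j) p)"
  by (induction ks) (simp_all add: hecke_sum)

text \<open>At a descent of \<open>p\<close> the argument \<open>p \<circ> adj i\<close> is an
  ascent, where \<open>hecke b i f\<close> vanishes, so only the diagonal term survives.\<close>

lemma hecke_square: "hecke b i (hecke b i f) = (\<lambda>p. b * hecke b i f p)"
  by (rule ext) (auto simp: hecke_def)

lemma hecke_commute:
  assumes "i + 2 \<le> j"
  shows "hecke b i (hecke b j f) = hecke b j (hecke b i f)"
proof -
  have "p \<circ> adj i \<circ> adj j = p \<circ> adj j \<circ> adj i" for p :: "nat \<Rightarrow> nat"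
    using assms by (intro ext) (auto simp: Transposition.transpose_def)
  then show ?thesis
    using assms by (intro ext) (auto simp: hecke_def algebra_simps Transposition.transpose_def)
qed

text \<open>Only the relative order of three consecutive values matters, ties included since
  \<open>p\<close> need not be injective. Both sides vanish unless the three values decrease
  strictly; in that case both expansions agree once the two words for the reversal of three places
  are identified.\<close>

lemma hecke_braid: "hecke b i (hecke b (Suc i) (hecke b i f)) = hecke b (Suc i) (hecke b i (hecke b (Suc i) f))"
proof (rule ext)
  fix p :: "nat \<Rightarrow> nat"
  have 1: "p \<circ> adj i \<circ> adj (Suc i) \<circ> adj i = p \<circ> adj (Suc i) \<circ> adj i \<circ> adj (Suc i)"
    by (intro ext) (auto simp: Transposition.transpose_def)
  have 2: "p \<circ> adj k \<circ> adj k = p" for k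
    by (intro ext) auto
  have 3: "(q \<circ> adj i) i = q (Suc i)" "(q \<circ> adj i) (Suc i) = q i" "(q \<circ> adj i) (Suc (Suc i)) = q (Suc (Suc i))"
    "(q \<circ> adj (Suc i)) i = q i" "(q \<circ> adj (Suc i)) (Suc i) = q (Suc (Suc i))" "(q \<circ> adj (Suc i)) (Suc (Suc i)) = q (Suc i)" for q :: "nat \<Rightarrow> nat"
    by (simp_all add: Transposition.transpose_def)
  consider "p i \<le> p (Suc i)" "p (Suc i) \<le> p (Suc (Suc i))" | "p i \<le> p (Suc (Suc i))" "p (Suc (Suc i)) < p (Suc i)" |
    "p (Suc i) < p i" "p i \<le> p (Suc (Suc i))" | "p (Suc (Suc i)) < p i" "p i \<le> p (Suc i)" | "p (Suc i) \<le> p (Suc (Suc i))" "p (Suc (Suc i)) < p i"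
   | "p (Suc (Suc i)) < p (Suc i)" "p (Suc i) < p i"
    by linarith
  then show "hecke b i (hecke b (Suc i) (hecke b i f)) p = hecke b (Suc i) (hecke b i (hecke b (Suc i) f)) p"
    unfolding hecke_def 3 1 2
    using 1 by cases (simp_all add: algebra_simps)
qed

section \<open>Extension of the action to the free algebra\<close>

lemma alg_act_superset:
  assumes "finite A" "Poly_Mapping.keys u \<subseteq> A"
  shows "alg_act b u f p = (\<Sum>w\<in>A. Poly_Mapping.lookup u w * word_act b (letters w) f p)"
  unfolding alg_act_def
  by (rule sum.mono_neutral_left) (use assms in \<open>auto simp: in_keys_iff\<close>)

lemma alg_act_zero [simp]: "alg_act b 0 f = (\<lambda>_. 0)"
  by (rule ext) (simp add: alg_act_def)

lemma alg_act_single: "alg_act b (Poly_Mapping.single w c) f p = c * word_act b (letters w) f p"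
  by (subst alg_act_superset [of "{w}"]) auto

lemma alg_act_add: "alg_act b (u + v) f p = alg_act b u f p + alg_act b v f p"
proof -
  let ?A = "Poly_Mapping.keys u \<union> Poly_Mapping.keys v"
  have "alg_act b (u + v) f p = (\<Sum>w\<in>?A. Poly_Mapping.lookup (u + v) w * word_act b (letters w) f p)"
    by (rule alg_act_superset) (use keys_add [of u v] in auto)
  moreover have "alg_act b u f p = (\<Sum>w\<in>?A. Poly_Mapping.lookup u w * word_act b (letters w) f p)"
    by (rule alg_act_superset) auto
  moreover have "alg_act b v f p = (\<Sum>w\<in>?A. Poly_Mapping.lookup v w * word_act b (letters w) f p)"
    by (rule alg_act_superset) auto
  ultimately show ?thesis
    by (simp add: lookup_add algebra_simps sum.distrib)
qed

lemma alg_act_uminus: "alg_act b (- u) f p = - alg_act b u f p"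
  using alg_act_add [of b u "- u" f p] by (simp add: eq_neg_iff_add_eq_0 add.commute)

lemma alg_act_diff: "alg_act b (u - v) f p = alg_act b u f p - alg_act b v f p"
  using alg_act_add [of b u "- v" f p] by (simp add: alg_act_uminus)

lemma alg_act_sum: "alg_act b (\<Sum>j\<in>J. u j) f p = (\<Sum>j\<in>J. alg_act b (u j) f p)"
  by (induction J rule: infinite_finite_induct) (simp_all add: alg_act_add)

lemma poly_mapping_sum_single:
  "u = (\<Sum>w\<in>Poly_Mapping.keys u. Poly_Mapping.single w (Poly_Mapping.lookup u w))"
  by (rule poly_mapping_eqI) (auto simp: lookup_sum lookup_single when_def in_keys_iff)

lemma alg_act_mult: "alg_act b (u * v) f = alg_act b u (alg_act b v f)"
proof (rule ext)
  fix p
  let ?u = "Poly_Mapping.lookup u" and ?v = "Poly_Mapping.lookup v"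
  have "u * v = (\<Sum>w\<in>Poly_Mapping.keys u. \<Sum>w'\<in>Poly_Mapping.keys v. Poly_Mapping.single (w + w') (?u w * ?v w'))"
    by (subst poly_mapping_sum_single [of u], subst poly_mapping_sum_single [of v])
      (simp add: sum_product mult_single)
  then have "alg_act b (u * v) f p =
      (\<Sum>w\<in>Poly_Mapping.keys u. \<Sum>w'\<in>Poly_Mapping.keys v. ?u w * ?v w' * word_act b (letters (w + w')) f p)"
    by (simp add: alg_act_sum alg_act_single)
  also have "\<dots> = (\<Sum>w\<in>Poly_Mapping.keys u. ?u w *
      (\<Sum>w'\<in>Poly_Mapping.keys v. ?v w' * word_act b (letters w) (word_act b (letters w') f) p))"
    by (simp add: plus_fword_def word_act_append sum_distrib_left mult.assoc)
  also have "\<dots> = alg_act b u (alg_act b v f) p"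
    unfolding alg_act_def [abs_def] word_act_sum ..
  finally show "alg_act b (u * v) f p = alg_act b u (alg_act b v f) p" .
qed

lemma alg_act_one: "alg_act b 1 f = f"
  by (rule ext) (simp add: alg_act_single zero_fword_def flip: single_one)

lemma alg_act_fgen: "alg_act b (fgen i) f = hecke b i f"
  by (rule ext) (simp add: fgen_def alg_act_single)

lemma alg_act_fscalar: "alg_act b (fscalar c) f = (\<lambda>p. c * f p)"
  by (rule ext) (simp add: fscalar_def alg_act_single zero_fword_def)

section \<open>The quotient algebra\<close>

definition fcarrier :: "nat \<Rightarrow> 'a :: comm_ring_1 free_alg set" where
  "fcarrier N = {f. \<forall>w\<in>Poly_Mapping.keys f. set (letters w) \<subseteq> {1..<N}}"

lemma free_algebra_simps [simp]:
  "carrier (free_algebra N) = fcarrier N"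
  "\<one>\<^bsub>free_algebra N\<^esub> = 1" "\<zero>\<^bsub>free_algebra N\<^esub> = 0"
  "u \<otimes>\<^bsub>free_algebra N\<^esub> v = u * v" "u \<oplus>\<^bsub>free_algebra N\<^esub> v = u + v"
  by (simp_all add: free_algebra_def fcarrier_def)

lemma fcarrierI:
  "(\<And>w. w \<in> Poly_Mapping.keys u \<Longrightarrow> set (letters w) \<subseteq> {1..<N}) \<Longrightarrow> u \<in> fcarrier N"
  unfolding fcarrier_def by blast

lemma fcarrierD: "u \<in> fcarrier N \<Longrightarrow> w \<in> Poly_Mapping.keys u \<Longrightarrow> set (letters w) \<subseteq> {1..<N}"
  unfolding fcarrier_def by blast

lemma fcarrier_add: "u \<in> fcarrier N \<Longrightarrow> v \<in> fcarrier N \<Longrightarrow> u + v \<in> fcarrier N"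
  using keys_add [of u v] unfolding fcarrier_def by blast

lemma fcarrier_uminus: "u \<in> fcarrier N \<Longrightarrow> - u \<in> fcarrier N"
  by (auto simp: in_keys_iff fcarrier_def)

lemma fcarrier_diff: "u \<in> fcarrier N \<Longrightarrow> v \<in> fcarrier N \<Longrightarrow> u - v \<in> fcarrier N"
  using fcarrier_add [of u N "- v"] fcarrier_uminus [of v N] by simp

lemma fcarrier_mult:
  assumes "u \<in> fcarrier N" "v \<in> fcarrier N"
  shows "u * v \<in> fcarrier N"
proof (rule fcarrierI)
  fix w assume "w \<in> Poly_Mapping.keys (u * v)"
  with keys_mult [of u v] obtain w1 w2
    where "w = w1 + w2" "w1 \<in> Poly_Mapping.keys u" "w2 \<in> Poly_Mapping.keys v"
    by blast
  with assms show "set (letters w) \<subseteq> {1..<N}"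
    using fcarrierD [of u N w1] fcarrierD [of v N w2] by (simp add: plus_fword_def)
qed

lemma fcarrier_zero: "0 \<in> fcarrier N"
  by (simp add: fcarrier_def)

lemma fcarrier_one: "1 \<in> fcarrier N"
  by (simp add: fcarrier_def zero_fword_def)

lemma fcarrier_sum: "(\<And>j. j \<in> J \<Longrightarrow> u j \<in> fcarrier N) \<Longrightarrow> (\<Sum>j\<in>J. u j) \<in> fcarrier N"
  by (induction J rule: infinite_finite_induct) (auto intro: fcarrier_zero fcarrier_add)

lemma fcarrier_single: "set ks \<subseteq> {1..<N} \<Longrightarrow> Poly_Mapping.single (FWord ks) c \<in> fcarrier N"
  by (auto simp: fcarrier_def)

lemma fcarrier_fgen: "i \<in> {1..<N} \<Longrightarrow> fgen i \<in> fcarrier N"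
  by (simp add: fgen_def fcarrier_single)

lemma fcarrier_fscalar: "fscalar c \<in> fcarrier N"
  by (simp add: fscalar_def zero_fword_def fcarrier_single)

lemma free_algebra_ring: "ring (free_algebra N :: 'a :: comm_ring_1 free_alg ring)"
proof (rule ringI)
  show "abelian_group (free_algebra N :: 'a free_alg ring)"
  proof (rule abelian_groupI)
    fix u :: "'a free_alg" assume "u \<in> carrier (free_algebra N)"
    then show "\<exists>v\<in>carrier (free_algebra N). v \<oplus>\<^bsub>free_algebra N\<^esub> u = \<zero>\<^bsub>free_algebra N\<^esub>"
      using fcarrier_uminus [of u N] by (intro bexI [of _ "- u"]) simp_all
  qed (simp_all add: fcarrier_add fcarrier_zero ac_simps)
  show "Group.monoid (free_algebra N :: 'a free_alg ring)"
    by (rule monoidI) (simp_all add: fcarrier_mult fcarrier_one mult.assoc)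
qed (simp_all add: algebra_simps)

lemma free_algebra_a_inv:
  assumes "u \<in> fcarrier N"
  shows "\<ominus>\<^bsub>free_algebra N\<^esub> u = - u"
proof -
  interpret ring "free_algebra N" by (rule free_algebra_ring)
  show ?thesis
    by (rule minus_equality) (use assms fcarrier_uminus [of u N] in simp_all)
qed

lemma free_algebra_a_minus:
  assumes "u \<in> fcarrier N" "v \<in> fcarrier N"
  shows "u \<ominus>\<^bsub>free_algebra N\<^esub> v = u - v"
  using assms by (simp add: a_minus_def free_algebra_a_inv)

section \<open>The ideal of relations and its trivial action\<close>

lemma IdC_relators_subset: "IdC_relators N b \<subseteq> fcarrier N"
proof -
  have "fgen i * fgen j - fgen j * fgen i \<in> fcarrier N"
    "fgen i * fgen j * fgen i - fgen j * fgen i * fgen j \<in> fcarrier N"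
    "fgen i * fgen i - fscalar b * fgen i \<in> fcarrier N"
    if i: "i \<in> {1..<N}" and j: "j \<in> {1..<N}" for i j :: nat
    by (intro fcarrier_diff fcarrier_mult fcarrier_fgen fcarrier_fscalar i j)+
  then show ?thesis
    unfolding IdC_relators_def by blast
qed

lemma IdC_ideal_ideal: "ideal (IdC_ideal N b) (free_algebra N)"
  unfolding IdC_ideal_def
  by (rule ring.genideal_ideal [OF free_algebra_ring]) (use IdC_relators_subset in simp)

lemma IdC_relators_in_ideal: "IdC_relators N b \<subseteq> IdC_ideal N b"
  unfolding IdC_ideal_def
  by (rule ring.genideal_self [OF free_algebra_ring]) (use IdC_relators_subset in simp)

lemma IdC_ideal_fcarrier: "u \<in> IdC_ideal N b \<Longrightarrow> u \<in> fcarrier N"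
  using ideal.Icarr [OF IdC_ideal_ideal] by simp

lemma IdC_ideal_zero: "0 \<in> IdC_ideal N b"
  using additive_subgroup.zero_closed [OF ideal.axioms(1) [OF IdC_ideal_ideal [of N b]]] by simp

lemma IdC_ideal_add: "u \<in> IdC_ideal N b \<Longrightarrow> v \<in> IdC_ideal N b \<Longrightarrow> u + v \<in> IdC_ideal N b"
  using additive_subgroup.a_closed [OF ideal.axioms(1) [OF IdC_ideal_ideal [of N b]]] by simp

lemma IdC_ideal_uminus: "u \<in> IdC_ideal N b \<Longrightarrow> - u \<in> IdC_ideal N b"
  using additive_subgroup.a_inv_closed [OF ideal.axioms(1) [OF IdC_ideal_ideal [of N b]]]
    free_algebra_ring free_algebra_a_inv [OF IdC_ideal_fcarrier, of u N b]
  by (metis abelian_group.a_group ring_def)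

lemma IdC_ideal_diff: "u \<in> IdC_ideal N b \<Longrightarrow> v \<in> IdC_ideal N b \<Longrightarrow> u - v \<in> IdC_ideal N b"
  using IdC_ideal_add [of u N b "- v"] IdC_ideal_uminus [of v N b] by simp

lemma IdC_ideal_mult_left: "u \<in> IdC_ideal N b \<Longrightarrow> v \<in> fcarrier N \<Longrightarrow> v * u \<in> IdC_ideal N b"
  using ideal.I_l_closed [OF IdC_ideal_ideal [of N b], of u v] by simp

lemma IdC_ideal_mult_right: "u \<in> IdC_ideal N b \<Longrightarrow> v \<in> fcarrier N \<Longrightarrow> u * v \<in> IdC_ideal N b"
  using ideal.I_r_closed [OF IdC_ideal_ideal [of N b], of u v] by simp

lemma IdC_ideal_sum: "(\<And>j. j \<in> J \<Longrightarrow> u j \<in> IdC_ideal N b) \<Longrightarrow> (\<Sum>j\<in>J. u j) \<in> IdC_ideal N b"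
  by (induction J rule: infinite_finite_induct) (auto intro: IdC_ideal_zero IdC_ideal_add)

lemma alg_act_relator:
  assumes "u \<in> IdC_relators N b"
  shows "alg_act b u f = (\<lambda>_. 0)"
proof -
  have comm: "hecke b i (hecke b j f) = hecke b j (hecke b i f)" if "2 \<le> \<bar>int i - int j\<bar>" for i j
  proof (cases "i \<le> j")
    case True
    with that show ?thesis by (intro hecke_commute) linarith
  next
    case False
    with that show ?thesis by (intro hecke_commute [symmetric]) linarith
  qed
  have braid: "hecke b i (hecke b j (hecke b i f)) = hecke b j (hecke b i (hecke b j f))" if "\<bar>int i - int j\<bar> = 1" for i j
  proof -
    from that consider "j = Suc i" | "i = Suc j" by linarith
    then show ?thesis
      using hecke_braid [of b i f] hecke_braid [of b j f] by cases metis+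
  qed
  consider i j where "u = fgen i * fgen j - fgen j * fgen i" "2 \<le> \<bar>int i - int j\<bar>"
    | i j where "u = fgen i * fgen j * fgen i - fgen j * fgen i * fgen j" "\<bar>int i - int j\<bar> = 1"
    | i where "u = fgen i * fgen i - fscalar b * fgen i"
    using assms unfolding IdC_relators_def by blast
  then show ?thesis
  proof cases
    case 1
    then show ?thesis
      by (simp add: fun_eq_iff alg_act_diff alg_act_mult alg_act_fgen comm [of i j])
  next
    case 2
    then show ?thesis
      by (simp add: fun_eq_iff alg_act_diff alg_act_mult alg_act_fgen braid [of i j])
  next
    case 3
    then show ?thesis
      by (simp add: fun_eq_iff alg_act_diff alg_act_mult alg_act_fgen alg_act_fscalar hecke_square)
  qed
qed

text \<open>The ideal is the least one containing the relators, so it is enough that the annihilator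
  of the module is an ideal containing them.\<close>

lemma alg_act_ideal:
  assumes "u \<in> IdC_ideal N b"
  shows "alg_act b u f = (\<lambda>_. 0)"
proof -
  \<comment> \<open>Quantifying over all \<open>f\<close> gives closure under right multiplication:
    \<open>u * v\<close> acts on \<open>f\<close> as \<open>u\<close> acts on the image of
    \<open>f\<close> under \<open>v\<close>. Closure under left multiplication needs
    \<open>hz\<close>.\<close>
  let ?Z = "{u \<in> fcarrier N. \<forall>f. alg_act b u f = (\<lambda>_. 0)}"
  interpret ring "free_algebra N :: 'a free_alg ring" by (rule free_algebra_ring)
  have hz: "alg_act b u (\<lambda>_. 0) = (\<lambda>_. 0)" for u :: "'a free_alg"
  proof -
    have "word_act b ks (\<lambda>_. 0) = (\<lambda>_. 0)" for ks
      by (induction ks) (simp_all add: hecke_def fun_eq_iff)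
    then show ?thesis
      by (simp add: alg_act_def [abs_def])
  qed
  have "ideal ?Z (free_algebra N)"
  proof (rule idealI)
    show "subgroup ?Z (add_monoid (free_algebra N))"
    proof (rule add.subgroupI)
      show "\<ominus>\<^bsub>free_algebra N\<^esub> u \<in> ?Z" if "u \<in> ?Z" for u
        using that free_algebra_a_inv [of u N] fcarrier_uminus [of u N]
        by (simp add: alg_act_uminus fun_eq_iff)
      show "?Z \<noteq> {}"
        using fcarrier_zero [of N] alg_act_zero [of b] by blast
      show "u \<oplus>\<^bsub>free_algebra N\<^esub> v \<in> ?Z" if "u \<in> ?Z" "v \<in> ?Z" for u v
        using that fcarrier_add [of u N v] by (simp add: alg_act_add fun_eq_iff)
    qed auto
  next
    fix u v :: "'a free_alg"
    assume "u \<in> ?Z" "v \<in> carrier (free_algebra N)"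
    then show "v \<otimes>\<^bsub>free_algebra N\<^esub> u \<in> ?Z" "u \<otimes>\<^bsub>free_algebra N\<^esub> v \<in> ?Z"
      using fcarrier_mult [of u N v] fcarrier_mult [of v N u] hz by (simp_all add: alg_act_mult)
  qed (rule free_algebra_ring)
  moreover have "IdC_relators N b \<subseteq> ?Z"
    using IdC_relators_subset [of N b] alg_act_relator [of _ N b] by blast
  ultimately have "IdC_ideal N b \<subseteq> ?Z"
    unfolding IdC_ideal_def by (rule genideal_minimal)
  with assms show ?thesis
    by blast
qed

section \<open>Words and permutations\<close>

text \<open>The inverse of \<open>word_perm\<close>, built letter by letter in the form
  \<open>p \<circ> adj k\<close> in which \<open>hecke\<close> shifts its argument.\<close>

definition word_inv :: "nat list \<Rightarrow> nat \<Rightarrow> nat" where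
  "word_inv ks = foldr (\<lambda>k p. p \<circ> adj k) ks id"

lemma word_inv_Nil [simp]: "word_inv [] = id"
  by (simp add: word_inv_def)

lemma word_inv_Cons [simp]: "word_inv (k # ks) = word_inv ks \<circ> adj k"
  by (simp add: word_inv_def)

lemma word_inv_append: "word_inv (ks @ ls) = word_inv ls \<circ> word_inv ks"
  by (induction ks) (simp_all add: comp_assoc)

lemma word_perm_Nil [simp]: "word_perm [] = id"
  by (simp add: word_perm_def)

lemma word_perm_Cons [simp]: "word_perm (k # ks) = adj k \<circ> word_perm ks"
  by (simp add: word_perm_def)

lemma permutes_adj: "k \<in> {1..<n} \<Longrightarrow> adj k permutes {1..n}"
  by (rule permutes_swap_id) auto

lemma word_inv_permutes: "set ks \<subseteq> {1..<n} \<Longrightarrow> word_inv ks permutes {1..n}"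
  by (induction ks) (auto intro!: permutes_id permutes_compose permutes_adj [simplified])

lemma word_perm_permutes: "set ks \<subseteq> {1..<n} \<Longrightarrow> word_perm ks permutes {1..n}"
  by (induction ks) (auto intro!: permutes_id permutes_compose permutes_adj [simplified])

lemma word_inv_o_word_perm: "word_inv ks \<circ> word_perm ks = id"
proof (induction ks)
  case (Cons k ks)
  have "word_inv (k # ks) \<circ> word_perm (k # ks) = word_inv ks \<circ> (adj k \<circ> adj k) \<circ> word_perm ks"
    by (simp only: word_inv_Cons word_perm_Cons comp_assoc)
  also have "adj k \<circ> adj k = id"
    by simp
  finally show ?case
    using Cons by simp
qed simp

lemma word_perm_o_word_inv: "word_perm ks \<circ> word_inv ks = id"
proof (induction ks)
  case (Cons k ks)
  have "word_perm (k # ks) \<circ> word_inv (k # ks) = adj k \<circ> (word_perm ks \<circ> word_inv ks) \<circ> adj k"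
    by (simp only: word_inv_Cons word_perm_Cons comp_assoc)
  also have "word_perm ks \<circ> word_inv ks = id"
    by (rule Cons)
  finally show ?case
    by simp
qed simp

lemma inv_word_perm: "inv_into UNIV (word_perm ks) = word_inv ks"
  by (rule inv_unique_comp) (rule word_perm_o_word_inv word_inv_o_word_perm)+

lemma inv_word_inv: "inv_into UNIV (word_inv ks) = word_perm ks"
  by (rule inv_unique_comp) (rule word_perm_o_word_inv word_inv_o_word_perm)+

lemma bij_word_inv: "bij (word_inv ks)"
  by (rule o_bij) (rule word_perm_o_word_inv word_inv_o_word_perm)+

lemma word_perm_eq_iff: "word_perm ks = word_perm ls \<longleftrightarrow> word_inv ks = word_inv ls"
  by (metis inv_word_perm inv_word_inv)

section \<open>Point masses and ascents\<close>

definition indic :: "(nat \<Rightarrow> nat) \<Rightarrow> (nat \<Rightarrow> nat) \<Rightarrow> 'a :: comm_ring_1" where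
  "indic p q = (if q = p then 1 else 0)"

text \<open>This is the length-increasing rule e_i e_w = e_{s_i w}: in terms of the inverse p of w,
  the length grows exactly when p ascends at i.\<close>

lemma hecke_indic:
  assumes "p i < p (Suc i)"
  shows "hecke b i (indic p) = indic (p \<circ> adj i)"
proof (rule ext)
  fix q
  have 1: "q \<circ> adj i = p \<longleftrightarrow> q = p \<circ> adj i"
    by (auto simp: fun_eq_iff) (metis transpose_involutory)+
  show "hecke b i (indic p) q = indic (p \<circ> adj i) q"
  proof (cases "q = p \<circ> adj i")
    case True
    then have "q i = p (Suc i)"
      by simp
    with assms have "q \<noteq> p"
      by auto
    from True have "q (Suc i) < q i"
      using assms by simp
    then show ?thesis
      using 1 True \<open>q \<noteq> p\<close> by (simp add: hecke_def indic_def)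
  next
    case False
    then show ?thesis
      using 1 assms by (auto simp: hecke_def indic_def)
  qed
qed

section \<open>Canonical words\<close>

text \<open>The choice \<open>j = Suc n\<close> stands for the empty block, so there are n! words,
  one for each permutation of {1..n}.\<close>

fun canon :: "nat \<Rightarrow> nat list set" where
  "canon 0 = {[]}"
| "canon (Suc n) = {[j..<Suc n] @ ks | j ks. j \<in> {1..Suc n} \<and> ks \<in> canon n}"

lemma finite_canon: "finite (canon n)"
proof (induction n)
  case (Suc n)
  have "canon (Suc n) = (\<lambda>(j, ks). [j..<Suc n] @ ks) ` ({1..Suc n} \<times> canon n)"
    unfolding canon.simps by (auto simp del: upt_Suc simp: image_iff Bex_def) blast
  then show ?case
    using Suc by simp
qed simp

lemma canon_letters: "ks \<in> canon n \<Longrightarrow> set ks \<subseteq> {1..<n}"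
proof (induction n arbitrary: ks)
  case (Suc n)
  then obtain j ls where "ks = [j..<Suc n] @ ls" "j \<in> {1..Suc n}" "ls \<in> canon n"
    by auto
  moreover from Suc.IH [OF this(3)] have "set ls \<subseteq> {1..<Suc n}"
    by (rule order_trans) auto
  ultimately show ?case
    by auto
qed simp

text \<open>As \<open>p\<close> fixes \<open>Suc n\<close>, the block carries this largest value
  from its own place down to place \<open>j\<close>, each time across a smaller value. Every letter
  thus acts at an ascent and \<open>hecke_indic\<close> applies.\<close>

lemma word_inv_upt_step:
  assumes "p permutes {1..n}" "j \<in> {1..Suc n}"
  shows "(p \<circ> word_inv [j..<Suc n]) j = Suc n"
    and "word_act b [j..<Suc n] (indic p) = indic (p \<circ> word_inv [j..<Suc n])"
proof -
  \<comment> \<open>Descending induction on \<open>j\<close>. That the places below \<open>j\<close>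
    are still untouched is what identifies the next ascent.\<close>
  have "(p \<circ> word_inv [j..<Suc n]) j = Suc n \<and> (\<forall>k\<in>{1..<j}. (p \<circ> word_inv [j..<Suc n]) k = p k) \<and>
    word_act b [j..<Suc n] (indic p) = indic (p \<circ> word_inv [j..<Suc n])"
    using assms(2)
  proof (induction "Suc n - j" arbitrary: j)
    case 0
    then have "j = Suc n" by simp
    then show ?case
      using permutes_not_in [OF assms(1), of "Suc n"] by simp
  next
    case (Suc m)
    let ?q = "p \<circ> word_inv [Suc j..<Suc n]"
    from Suc have j: "1 \<le> j" "j \<le> n" by auto
    have IH: "?q (Suc j) = Suc n" "\<forall>k\<in>{1..<Suc j}. ?q k = p k"
      "word_act b [Suc j..<Suc n] (indic p) = indic ?q"
      using Suc.hyps(1) [of "Suc j"] Suc.hyps(2) j by auto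
    have upt: "[j..<Suc n] = j # [Suc j..<Suc n]"
      using j by (simp add: upt_conv_Cons del: upt_Suc)
    have w: "p \<circ> word_inv [j..<Suc n] = ?q \<circ> adj j"
      unfolding upt by (simp only: word_inv_Cons comp_assoc)
    have "p j \<le> n"
      using permutes_in_image [OF assms(1), of j] j by simp
    then have asc: "?q j < ?q (Suc j)"
      using IH(1,2) j by simp
    show ?case
      unfolding w
    proof (intro conjI ballI)
      show "(?q \<circ> adj j) j = Suc n"
        using IH(1) by simp
      show "(?q \<circ> adj j) k = p k" if "k \<in> {1..<j}" for k
        using IH(2) that by (simp add: Transposition.transpose_def)
      show "word_act b [j..<Suc n] (indic p) = indic (?q \<circ> adj j)"
        unfolding upt word_act_Cons IH(3) using asc by (rule hecke_indic)
    qed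
  qed
  then show "(p \<circ> word_inv [j..<Suc n]) j = Suc n"
    and "word_act b [j..<Suc n] (indic p) = indic (p \<circ> word_inv [j..<Suc n])"
    by blast+
qed

lemma word_act_canon:
  "ks \<in> canon n \<Longrightarrow> word_act b ks (indic id) = indic (word_inv ks)"
proof (induction n arbitrary: ks)
  case (Suc n)
  then obtain j ls where "ks = [j..<Suc n] @ ls" "j \<in> {1..Suc n}" "ls \<in> canon n"
    by auto
  then show ?case
    using Suc.IH [of ls] word_inv_upt_step(2) [OF word_inv_permutes [OF canon_letters], of ls n j b]
    by (simp only: word_act_append word_inv_append)
qed simp

text \<open>The place of the value \<open>Suc n\<close> reveals the start of the first block; the
  block can then be cancelled.\<close>

lemma word_inv_inj_on_canon: "inj_on word_inv (canon n)"
proof (induction n)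
  case (Suc n)
  show ?case
  proof (rule inj_onI)
    fix ks ks' assume "ks \<in> canon (Suc n)" "ks' \<in> canon (Suc n)" and eq: "word_inv ks = word_inv ks'"
    then obtain j ls j' ls' where
      ks: "ks = [j..<Suc n] @ ls" "j \<in> {1..Suc n}" "ls \<in> canon n" and
      ks': "ks' = [j'..<Suc n] @ ls'" "j' \<in> {1..Suc n}" "ls' \<in> canon n"
      by auto
    have "word_inv ks j = Suc n" "word_inv ks' j' = Suc n"
      using word_inv_upt_step(1) [OF word_inv_permutes [OF canon_letters]] ks ks'
      by (simp_all add: word_inv_append del: upt_Suc)
    with eq have "word_inv ks j = word_inv ks j'"
      by simp
    then have j: "j = j'"
      using bij_word_inv [of ks] by (simp add: bij_def inj_eq)
    have "word_inv ls \<circ> word_inv [j..<Suc n] \<circ> word_perm [j..<Suc n]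
        = word_inv ls' \<circ> word_inv [j..<Suc n] \<circ> word_perm [j..<Suc n]"
      using eq ks ks' j by (simp add: word_inv_append del: upt_Suc)
    then have "word_inv ls = word_inv ls'"
      by (simp add: comp_assoc word_inv_o_word_perm del: upt_Suc)
    then show "ks = ks'"
      using Suc.IH ks ks' j by (auto dest: inj_onD)
  qed
qed simp

lemma canon_exists:
  "p permutes {1..n} \<Longrightarrow> \<exists>ks\<in>canon n. word_inv ks = p"
proof (induction n arbitrary: p)
  case (Suc n)
  \<comment> \<open>The place of the largest value is the only possible start of the first
    block.\<close>
  define j where "j = inv_into UNIV p (Suc n)"
  have pj: "p j = Suc n"
    unfolding j_def by (rule permutes_inverses(1) [OF Suc.prems])
  have j: "j \<in> {1..Suc n}"
    using permutes_in_image [OF Suc.prems, of j] pj by simp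
  define q where "q = p \<circ> word_perm [j..<Suc n]"
  have "word_perm [j..<Suc n] (Suc n) = j"
    using word_inv_upt_step(1) [OF permutes_id j] fun_cong [OF word_perm_o_word_inv [of "[j..<Suc n]"], of j]
    by (simp del: upt_Suc)
  then have "q (Suc n) = Suc n"
    by (simp add: q_def pj del: upt_Suc)
  moreover have "q permutes {1..Suc n}"
    unfolding q_def by (rule permutes_compose [OF word_perm_permutes Suc.prems]) (use j in auto)
  ultimately have "q permutes {1..n}"
    by (elim permutes_superset) (auto simp: le_Suc_eq)
  from Suc.IH [OF this] obtain ls where ls: "ls \<in> canon n" "word_inv ls = q"
    by blast
  have "word_inv ([j..<Suc n] @ ls) = p"
    by (simp add: word_inv_append ls q_def comp_assoc word_perm_o_word_inv del: upt_Suc)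
  then show ?case
    using ls(1) j by (intro bexI [of _ "[j..<Suc n] @ ls"]) (auto simp del: upt_Suc)
qed simp

section \<open>Reduced words\<close>

lemma transpose_conjugate:
  "adj l \<circ> Transposition.transpose (adj l i) (adj l j) = Transposition.transpose i j \<circ> adj l"
  by (rule ext) (auto simp: Transposition.transpose_def)

text \<open>The strong exchange condition. If the first letter keeps \<open>i\<close> and
  \<open>j\<close> in order, the inversion is passed to the tail with \<open>i\<close> and
  \<open>j\<close> conjugated by that letter; otherwise \<open>i\<close> and \<open>j\<close> are
  the two places it swaps, and deleting it does the job.\<close>

lemma word_exchange:
  assumes "i < j" "word_inv ks j < word_inv ks i"
  shows "\<exists>ls. set ls \<subseteq> set ks \<and> length ls < length ks \<and>
    word_perm ls = Transposition.transpose i j \<circ> word_perm ks"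
  using assms
proof (induction ks arbitrary: i j)
  case (Cons l ks)
  show ?case
  proof (cases "adj l i < adj l j")
    case True
    with Cons.IH [of "adj l i" "adj l j"] Cons.prems obtain ls where
      ls: "set ls \<subseteq> set ks" "length ls < length ks"
        "word_perm ls = Transposition.transpose (adj l i) (adj l j) \<circ> word_perm ks"
      unfolding word_inv_Cons comp_apply by blast
    have "word_perm (l # ls) = Transposition.transpose i j \<circ> word_perm (l # ks)"
      by (simp only: word_perm_Cons ls(3) comp_assoc [symmetric] transpose_conjugate)
    with ls show ?thesis
      by (intro exI [of _ "l # ls"]) auto
  next
    case False
    with Cons.prems have "i = l" "j = Suc l"
      by (auto simp: Transposition.transpose_def split: if_splits)
    then have "word_perm ks = Transposition.transpose i j \<circ> word_perm (l # ks)"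
      by (simp add: fun_eq_iff)
    then show ?thesis
      by (intro exI [of _ ks] conjI) (assumption | force)+
  qed
qed simp

text \<open>If the tail had a descent at \<open>k\<close>, the exchange condition would produce a
  word for the same permutation that is shorter than the tail, against minimality.\<close>

lemma reduced_word_ConsD:
  assumes "reduced_word N w (k # ks)"
  shows "reduced_word N (word_perm ks) ks" and "word_inv ks k < word_inv ks (Suc k)"
proof -
  from assms have k: "k \<in> {1..<N}" "set ks \<subseteq> {1..<N}" and w: "w = adj k \<circ> word_perm ks"
    and min: "\<And>ls. set ls \<subseteq> {1..<N} \<Longrightarrow> word_perm ls = w \<Longrightarrow> length (k # ks) \<le> length ls"
    by (auto simp: reduced_word_def)
  show "reduced_word N (word_perm ks) ks"
    unfolding reduced_word_def
    using k min [of "k # _"] w by auto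
  show "word_inv ks k < word_inv ks (Suc k)"
  proof (rule ccontr)
    assume "\<not> ?thesis"
    moreover have "word_inv ks k \<noteq> word_inv ks (Suc k)"
      using bij_word_inv [of ks] by (simp add: bij_def inj_eq)
    ultimately have "word_inv ks (Suc k) < word_inv ks k"
      by simp
    from word_exchange [OF _ this] obtain ls
      where "set ls \<subseteq> set ks" "length ls < length ks" "word_perm ls = adj k \<circ> word_perm ks"
      by auto
    with min [of ls] k w show False
      by auto
  qed
qed

lemma word_act_reduced:
  "reduced_word N w ks \<Longrightarrow> word_act b ks (indic id) = indic (inv_into UNIV w)"
proof (induction ks arbitrary: w)
  case Nil
  then show ?case
    by (simp add: reduced_word_def flip: inv_word_perm [of "[]"])
next
  case (Cons k ks)
  then have w: "w = word_perm (k # ks)"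
    by (simp add: reduced_word_def)
  show ?case
    using Cons.IH [OF reduced_word_ConsD(1) [OF Cons.prems]]
      hecke_indic [where b = b, OF reduced_word_ConsD(2) [OF Cons.prems]]
    unfolding w by (simp only: word_act_Cons inv_word_perm word_inv_Cons)
qed

lemma reduced_word_exists:
  assumes "w permutes {1..N}"
  shows "\<exists>ks. reduced_word N w ks"
proof -
  let ?P = "\<lambda>ks. set ks \<subseteq> {1..<N} \<and> word_perm ks = w"
  from canon_exists [OF permutes_inv [OF assms]] obtain ks
    where ks: "ks \<in> canon N" "word_inv ks = inv_into UNIV w"
    by blast
  have "word_perm ks = w"
    using ks(2) inv_word_inv [of ks] permutes_inv_inv [OF assms] by simp
  with canon_letters [OF ks(1)] have "?P ks"
    by blast
  from ex_has_least_nat [of ?P, OF this, of length] show ?thesis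
    unfolding reduced_word_def by blast
qed

section \<open>The canonical words span\<close>

abbreviation fmon :: "'a :: comm_ring_1 \<Rightarrow> nat list \<Rightarrow> 'a free_alg" where
  "fmon c ks \<equiv> Poly_Mapping.single (FWord ks) c"

lemma fmon_mult: "fmon c ks * fmon d ls = fmon (c * d) (ks @ ls)"
  by (simp add: mult_single plus_fword_def)

lemma fscalar_mult_fmon: "fscalar c * fmon d ls = fmon (c * d) ls"
  by (simp add: fscalar_def mult_single zero_fword_def plus_fword_def)

lemma fgen_eq_fmon: "fgen i = fmon 1 [i]"
  by (simp add: fgen_def)

definition word_cong :: "nat \<Rightarrow> 'a :: comm_ring_1 \<Rightarrow> nat list \<Rightarrow> nat list \<Rightarrow> bool" where
  "word_cong N b ks ls \<longleftrightarrow> fmon 1 ks - fmon 1 ls \<in> IdC_ideal N b"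

lemma word_cong_refl: "word_cong N b ks ks"
  by (simp add: word_cong_def IdC_ideal_zero)

lemma word_cong_trans [trans]:
  "word_cong N b ks ls \<Longrightarrow> word_cong N b ls ms \<Longrightarrow> word_cong N b ks ms"
  unfolding word_cong_def using IdC_ideal_add [of "fmon 1 ks - fmon 1 ls" N b "fmon 1 ls - fmon 1 ms"]
  by simp

lemma word_cong_context:
  assumes "word_cong N b ks ls" "set as \<subseteq> {1..<N}" "set bs \<subseteq> {1..<N}"
  shows "word_cong N b (as @ ks @ bs) (as @ ls @ bs)"
proof -
  have "fmon 1 as * (fmon 1 ks - fmon 1 ls) * fmon 1 bs \<in> IdC_ideal N b"
    using assms unfolding word_cong_def
    by (intro IdC_ideal_mult_left IdC_ideal_mult_right fcarrier_single)
  then show ?thesis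
    by (simp add: word_cong_def algebra_simps fmon_mult)
qed

lemma word_cong_commute:
  assumes "i \<in> {1..<N}" "j \<in> {1..<N}" "2 \<le> \<bar>int i - int j\<bar>"
  shows "word_cong N b [i, j] [j, i]"
proof -
  have "fgen i * fgen j - fgen j * fgen i \<in> IdC_ideal N b"
    using assms IdC_relators_in_ideal [of N b] unfolding IdC_relators_def by blast
  then show ?thesis
    by (simp add: word_cong_def fgen_eq_fmon fmon_mult)
qed

lemma word_cong_braid:
  assumes "i \<in> {1..<N}" "j \<in> {1..<N}" "\<bar>int i - int j\<bar> = 1"
  shows "word_cong N b [i, j, i] [j, i, j]"
proof -
  have "fgen i * fgen j * fgen i - fgen j * fgen i * fgen j \<in> IdC_ideal N b"
    using assms IdC_relators_in_ideal [of N b] unfolding IdC_relators_def by blast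
  then show ?thesis
    by (simp add: word_cong_def fgen_eq_fmon fmon_mult)
qed

lemma word_cong_move:
  assumes "i \<in> {1..<N}" "set xs \<subseteq> {1..<N}" "\<And>x. x \<in> set xs \<Longrightarrow> 2 \<le> \<bar>int i - int x\<bar>"
  shows "word_cong N b (i # xs) (xs @ [i])"
  using assms(2,3)
proof (induction xs)
  case (Cons x xs)
  have "word_cong N b ([] @ [i, x] @ xs) ([] @ [x, i] @ xs)"
    using Cons.prems assms(1) by (intro word_cong_context word_cong_commute) auto
  moreover have "word_cong N b ([x] @ (i # xs) @ []) ([x] @ (xs @ [i]) @ [])"
    using Cons.prems assms(1) by (intro word_cong_context Cons.IH) auto
  ultimately show ?case
    using word_cong_trans by simp
qed (simp add: word_cong_refl)

text \<open>The letter \<open>i\<close> commutes with the letters up to \<open>i - 2\<close>, meets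
  \<open>i - 1, i\<close> in a braid relation that turns it into \<open>i - 1\<close>, and this
  letter commutes with everything from \<open>i + 1\<close> on.\<close>

lemma word_cong_move_upt:
  assumes "j < i" "i \<le> n" "1 \<le> j" "n < N"
  shows "word_cong N b (i # [j..<Suc n]) ([j..<Suc n] @ [i - 1])"
proof -
  obtain k where i: "i = Suc k"
    using assms(1) by (cases i) auto
  have upt: "[j..<Suc n] = [j..<k] @ [k, i] @ [Suc i..<Suc n]"
    using assms i upt_add_eq_append [of j k "Suc n - k"] by (simp add: upt_conv_Cons del: upt_Suc)
  have "word_cong N b ([] @ (i # [j..<k]) @ ([k, i] @ [Suc i..<Suc n]))
      ([] @ ([j..<k] @ [i]) @ ([k, i] @ [Suc i..<Suc n]))"
    using assms i by (intro word_cong_context word_cong_move) auto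
  also have "[] @ ([j..<k] @ [i]) @ ([k, i] @ [Suc i..<Suc n]) = [j..<k] @ [i, k, i] @ [Suc i..<Suc n]"
    by simp
  also have "word_cong N b \<dots> ([j..<k] @ [k, i, k] @ [Suc i..<Suc n])"
    using assms i by (intro word_cong_context word_cong_braid) auto
  also have "[j..<k] @ [k, i, k] @ [Suc i..<Suc n] = ([j..<k] @ [k, i]) @ (k # [Suc i..<Suc n]) @ []"
    by simp
  also have "word_cong N b \<dots> (([j..<k] @ [k, i]) @ ([Suc i..<Suc n] @ [k]) @ [])"
    using assms i by (intro word_cong_context word_cong_move) auto
  finally show ?thesis
    unfolding upt using i by simp
qed

text \<open>Presented by generators so that closure under left multiplication by e_i can be checked
  on single canonical words.\<close>

inductive_set canon_span :: "nat \<Rightarrow> 'a :: comm_ring_1 \<Rightarrow> nat \<Rightarrow> 'a free_alg set" for N b n where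
  ideal: "u \<in> IdC_ideal N b \<Longrightarrow> u \<in> canon_span N b n"
| mon: "ks \<in> canon n \<Longrightarrow> fmon c ks \<in> canon_span N b n"
| add: "u \<in> canon_span N b n \<Longrightarrow> v \<in> canon_span N b n \<Longrightarrow> u + v \<in> canon_span N b n"

lemma canon_span_cong:
  assumes "word_cong N b ks ls" "fmon c ls \<in> canon_span N b n"
  shows "fmon c ks \<in> canon_span N b n"
proof -
  have "fscalar c * (fmon 1 ks - fmon 1 ls) \<in> IdC_ideal N b"
    using assms(1) unfolding word_cong_def by (rule IdC_ideal_mult_left) (rule fcarrier_fscalar)
  then have "fmon c ks - fmon c ls \<in> IdC_ideal N b"
    by (simp add: algebra_simps fscalar_mult_fmon)
  from canon_span.add [OF canon_span.ideal [OF this] assms(2)] show ?thesis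
    by simp
qed

lemma canon_span_upt:
  assumes "u \<in> canon_span N b n" "j \<in> {1..Suc n}" "n < N"
  shows "fmon 1 [j..<Suc n] * u \<in> canon_span N b (Suc n)"
  using assms(1)
proof induction
  case (ideal u)
  then have "fmon 1 [j..<Suc n] * u \<in> IdC_ideal N b"
    by (rule IdC_ideal_mult_left) (use assms in \<open>intro fcarrier_single, auto\<close>)
  then show ?case
    by (rule canon_span.ideal)
next
  case (mon ks c)
  then show ?case
    unfolding fmon_mult using assms(2) by (intro canon_span.mon) (auto simp del: upt_Suc)
next
  case (add u v)
  then show ?case
    unfolding distrib_left by (intro canon_span.add)
qed

text \<open>A new first letter has three possible fates: it passes through the leading block and
  becomes a letter below \<open>n\<close>, to which induction applies (\<open>step\<close>); it
  prolongs the block by one; or it equals the first letter of the block and is absorbed by the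
  quadratic relation.\<close>

lemma canon_span_Cons_canon:
  "i \<in> {1..<n} \<Longrightarrow> n \<le> N \<Longrightarrow> ks \<in> canon n \<Longrightarrow> fmon c (i # ks) \<in> canon_span N b n"
proof (induction n arbitrary: i ks)
  case (Suc n)
  from Suc.prems(3) obtain j ls where ks: "ks = [j..<Suc n] @ ls" and j: "j \<in> {1..Suc n}" and ls: "ls \<in> canon n"
    by auto
  have lsN: "set ls \<subseteq> {1..<N}"
    using canon_letters [OF ls] Suc.prems(2) by auto
  have step: "fmon c (i # ks) \<in> canon_span N b (Suc n)"
    if k: "k \<in> {1..<n}" and cong: "word_cong N b (i # [j..<Suc n]) ([j..<Suc n] @ [k])" for k
  proof -
    have "word_cong N b ([] @ (i # [j..<Suc n]) @ ls) ([] @ ([j..<Suc n] @ [k]) @ ls)"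
      using cong lsN by (intro word_cong_context) auto
    moreover have "fmon 1 [j..<Suc n] * fmon c (k # ls) \<in> canon_span N b (Suc n)"
      using Suc.prems(2) k j ls by (intro canon_span_upt Suc.IH) auto
    ultimately show ?thesis
      unfolding ks fmon_mult by (intro canon_span_cong [where ks = "i # [j..<Suc n] @ ls"]) (simp_all del: upt_Suc)
  qed
  consider "Suc i < j" | "Suc i = j" | "i = j" | "j < i"
    by linarith
  then show ?case
  proof cases
    case 1
    then have "word_cong N b (i # [j..<Suc n]) ([j..<Suc n] @ [i])"
      using Suc.prems j by (intro word_cong_move) auto
    then show ?thesis
      using step [of i] 1 Suc.prems(1) j by auto
  next
    case 2
    then have "i # ks = [i..<Suc n] @ ls"
      using Suc.prems(1) by (simp add: ks upt_conv_Cons del: upt_Suc)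
    moreover have "[i..<Suc n] @ ls \<in> canon (Suc n)"
      using ls Suc.prems(1) unfolding canon.simps by auto
    ultimately show ?thesis
      by (simp only: canon_span.mon)
  next
    case 3
    then have ks': "ks = i # [Suc i..<Suc n] @ ls" 
      using Suc.prems(1) by (simp add: ks upt_conv_Cons del: upt_Suc)
    have "fgen i * fgen i - fscalar b * fgen i \<in> IdC_ideal N b"
    proof -
      have "i \<in> {1..<N}"
        using Suc.prems by auto
      then show ?thesis
        using IdC_relators_in_ideal [of N b] unfolding IdC_relators_def by blast
    qed
    then have "(fgen i * fgen i - fscalar b * fgen i) * fmon c ([Suc i..<Suc n] @ ls) \<in> IdC_ideal N b"
      by (rule IdC_ideal_mult_right) (use Suc.prems lsN in \<open>intro fcarrier_single, auto\<close>)
    then have "fmon c (i # ks) - fmon (b * c) ks \<in> IdC_ideal N b"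
      by (simp add: algebra_simps fgen_eq_fmon fmon_mult fscalar_mult_fmon ks' del: upt_Suc)
    from canon_span.add [OF canon_span.ideal [OF this] canon_span.mon [OF Suc.prems(3), of "b * c"]]
    show ?thesis
      by simp
  next
    case 4
    then have "word_cong N b (i # [j..<Suc n]) ([j..<Suc n] @ [i - 1])"
      using Suc.prems j by (intro word_cong_move_upt) auto
    then show ?thesis
      by (intro step [of "i - 1"]) (use 4 Suc.prems(1) j in auto)
  qed
qed simp

lemma canon_span_Cons:
  assumes "u \<in> canon_span N b N" "i \<in> {1..<N}"
  shows "fgen i * u \<in> canon_span N b N"
  using assms(1)
proof induction
  case (ideal u)
  then show ?case
    using assms(2) by (intro canon_span.ideal IdC_ideal_mult_left fcarrier_fgen)
next
  case (mon ks c)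
  then show ?case
    using canon_span_Cons_canon [OF assms(2), of N ks c b] by (simp add: fgen_eq_fmon fmon_mult)
next
  case (add u v)
  then show ?case
    unfolding distrib_left by (intro canon_span.add)
qed

lemma Nil_in_canon: "[] \<in> canon n"
proof (induction n)
  case (Suc n)
  then show ?case
    unfolding canon.simps by (intro CollectI exI [of _ "Suc n"] exI [of _ "[]"]) simp
qed simp

lemma fmon_in_canon_span: "set ks \<subseteq> {1..<N} \<Longrightarrow> fmon c ks \<in> canon_span N b N"
proof (induction ks)
  case Nil
  show ?case
    by (rule canon_span.mon) (rule Nil_in_canon)
next
  case (Cons k ks)
  then show ?case
    using canon_span_Cons [of "fmon c ks" N b k] by (simp add: fgen_eq_fmon fmon_mult)
qed

lemma fcarrier_canon_span:
  assumes "u \<in> fcarrier N"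
  shows "u \<in> canon_span N b N"
proof -
  have "(\<Sum>w\<in>A. Poly_Mapping.single w (Poly_Mapping.lookup u w)) \<in> canon_span N b N"
    if "finite A" "A \<subseteq> Poly_Mapping.keys u" for A
    using that
  proof (induction A rule: finite_induct)
    case (insert w A)
    then have "set (letters w) \<subseteq> {1..<N}"
      using fcarrierD [OF assms] by simp
    then have "Poly_Mapping.single w (Poly_Mapping.lookup u w) \<in> canon_span N b N"
      using fmon_in_canon_span [of "letters w"] by simp
    with insert show ?case
      by (simp add: canon_span.add)
  qed (simp add: canon_span.ideal IdC_ideal_zero)
  from this [of "Poly_Mapping.keys u"] show ?thesis
    using poly_mapping_sum_single [of u] by simp
qed

lemma canon_span_coeffs:
  assumes "u \<in> canon_span N b n"
  shows "\<exists>a. u - (\<Sum>ks\<in>canon n. fmon (a ks) ks) \<in> IdC_ideal N b"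
  using assms
proof induction
  case (ideal u)
  then show ?case
    by (intro exI [of _ "\<lambda>_. 0"]) simp
next
  case (mon ks c)
  have "(\<Sum>ls\<in>canon n. fmon (if ls = ks then c else 0) ls) = (\<Sum>ls\<in>canon n. if ls = ks then fmon c ks else 0)"
    by (rule sum.cong) auto
  also have "\<dots> = fmon c ks"
    using mon by (simp add: finite_canon)
  finally show ?case
    by (intro exI [of _ "\<lambda>ls. if ls = ks then c else 0"]) (simp add: IdC_ideal_zero)
next
  case (add u v)
  then obtain a a' where "u - (\<Sum>ks\<in>canon n. fmon (a ks) ks) \<in> IdC_ideal N b"
    "v - (\<Sum>ks\<in>canon n. fmon (a' ks) ks) \<in> IdC_ideal N b"
    by blast
  from IdC_ideal_add [OF this] show ?case
    by (intro exI [of _ "\<lambda>ks. a ks + a' ks"]) (simp add: single_add sum.distrib algebra_simps)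
qed

section \<open>Coordinates\<close>

definition cls :: "nat \<Rightarrow> 'a :: comm_ring_1 \<Rightarrow> 'a free_alg \<Rightarrow> 'a free_alg set" where
  "cls N b u = IdC_ideal N b +>\<^bsub>free_algebra N\<^esub> u"

lemma IdC_ring: "ring (IdC N b)"
  unfolding IdC_def by (rule ideal.quotient_is_ring) (rule IdC_ideal_ideal)

lemma cls_hom: "cls N b \<in> Ring.ring_hom (free_algebra N) (IdC N b)"
  using ideal.rcos_ring_hom [OF IdC_ideal_ideal [of N b]] by (simp add: cls_def [abs_def] IdC_def)

lemma cls_carrier: "u \<in> fcarrier N \<Longrightarrow> cls N b u \<in> carrier (IdC N b)"
  using ring_hom_closed [OF cls_hom] by simp

lemma cls_mult: "u \<in> fcarrier N \<Longrightarrow> v \<in> fcarrier N \<Longrightarrow> cls N b u \<otimes>\<^bsub>IdC N b\<^esub> cls N b v = cls N b (u * v)"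
  using ring_hom_mult [OF cls_hom, of u N v b] by simp

lemma cls_add: "u \<in> fcarrier N \<Longrightarrow> v \<in> fcarrier N \<Longrightarrow> cls N b u \<oplus>\<^bsub>IdC N b\<^esub> cls N b v = cls N b (u + v)"
  using ring_hom_add [OF cls_hom, of u N v b] by simp

lemma cls_one: "\<one>\<^bsub>IdC N b\<^esub> = cls N b 1"
  using ring_hom_one [OF cls_hom, of N b] by simp

lemma cls_zero: "\<zero>\<^bsub>IdC N b\<^esub> = cls N b 0"
  using ring_hom_zero [OF cls_hom free_algebra_ring IdC_ring, of N b] unfolding free_algebra_simps ..

lemma cls_eq_iff:
  assumes "u \<in> fcarrier N" "v \<in> fcarrier N"
  shows "cls N b u = cls N b v \<longleftrightarrow> u - v \<in> IdC_ideal N b"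
  using ring.quotient_eq_iff_same_a_r_cos [OF free_algebra_ring IdC_ideal_ideal, of u N v b] assms
  by (simp add: cls_def free_algebra_a_minus)

lemma IdC_prod_cls:
  assumes "\<And>u. u \<in> set us \<Longrightarrow> u \<in> fcarrier N"
  shows "IdC_prod N b (map (cls N b) us) = cls N b (prod_list us)" and "prod_list us \<in> fcarrier N"
proof -
  have "IdC_prod N b (map (cls N b) us) = cls N b (prod_list us) \<and> prod_list us \<in> fcarrier N"
    using assms
    by (induction us) (simp_all add: IdC_prod_def cls_one cls_mult fcarrier_mult fcarrier_one)
  then show "IdC_prod N b (map (cls N b) us) = cls N b (prod_list us)" and "prod_list us \<in> fcarrier N"
    by blast+
qed

lemma finsum_cls:
  assumes "finite A" "\<And>w. w \<in> A \<Longrightarrow> g w \<in> fcarrier N"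
  shows "finsum (IdC N b) (\<lambda>w. cls N b (g w)) A = cls N b (\<Sum>w\<in>A. g w)"
proof -
  interpret ring "IdC N b" by (rule IdC_ring)
  show ?thesis
    using assms
  proof (induction A rule: finite_induct)
    case (insert x A)
    then show ?case
      by (simp add: finsum_insert Pi_iff cls_carrier cls_add fcarrier_sum)
  qed (simp add: cls_zero)
qed

section \<open>Independence of the choice of reduced words\<close>

definition red_word :: "nat \<Rightarrow> (nat \<Rightarrow> nat) \<Rightarrow> nat list" where
  "red_word N w = (SOME ks. reduced_word N w ks)"

lemma red_word: "w permutes {1..N} \<Longrightarrow> reduced_word N w (red_word N w)"
  unfolding red_word_def by (rule someI_ex) (rule reduced_word_exists)

lemma red_word_letters: "w permutes {1..N} \<Longrightarrow> set (red_word N w) \<subseteq> {1..<N}"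
  using red_word unfolding reduced_word_def by blast

lemma prod_list_fgen: "prod_list (map fgen ks) = fmon 1 ks"
  by (induction ks) (simp_all add: fgen_eq_fmon fmon_mult flip: single_one zero_fword_def)

lemma IdC_perm_eq:
  assumes "w permutes {1..N}"
  shows "IdC_perm N b w = cls N b (fmon 1 (red_word N w))"
proof -
  have "map (IdC_gen N b) (red_word N w) = map (cls N b) (map fgen (red_word N w))"
    unfolding map_map by (simp add: IdC_gen_def [abs_def] cls_def)
  moreover have "u \<in> fcarrier N" if "u \<in> set (map fgen (red_word N w))" for u :: "'a free_alg"
    using that red_word_letters [OF assms] by (auto intro!: fcarrier_fgen)
  ultimately show ?thesis
    unfolding IdC_perm_def red_word_def [symmetric] prod_list_fgen [symmetric]
    using IdC_prod_cls(1) [of "map fgen (red_word N w)" N b] by (simp only:)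
qed

lemma word_perm_bij_canon: "bij_betw word_perm (canon N) {w. w permutes {1..N}}"
proof (rule bij_betw_imageI)
  show "inj_on word_perm (canon N)"
    using word_inv_inj_on_canon [of N] by (simp add: inj_on_def word_perm_eq_iff)
  have "w \<in> word_perm ` canon N" if w: "w permutes {1..N}" for w
  proof -
    from canon_exists [OF permutes_inv [OF w]] obtain ks
      where ks: "ks \<in> canon N" "word_inv ks = inv_into UNIV w"
      by blast
    with inv_word_inv [of ks] permutes_inv_inv [OF w] have "word_perm ks = w"
      by simp
    with ks show ?thesis
      by blast
  qed
  moreover have "word_perm ks permutes {1..N}" if "ks \<in> canon N" for ks
    using that by (intro word_perm_permutes canon_letters)
  ultimately show "word_perm ` canon N = {w. w permutes {1..N}}"
    by blast
qed

text \<open>This gives inside the algebra what Matsumoto's theorem gives for words. The chosen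
  reduced word has some expansion in canonical words, and since it acts on the identity as a single
  point mass, that expansion has a single term.\<close>

lemma word_cong_red_word:
  fixes b :: "'a :: comm_ring_1"
  assumes "ks \<in> canon N"
  shows "word_cong N b (red_word N (word_perm ks)) ks"
proof -
  let ?r = "red_word N (word_perm ks)"
  have w: "word_perm ks permutes {1..N}"
    by (rule word_perm_permutes [OF canon_letters [OF assms]])
  from canon_span_coeffs [OF fmon_in_canon_span [OF red_word_letters [OF w]]]
  obtain a where a: "fmon 1 ?r - (\<Sum>ls\<in>canon N. fmon (a ls) ls) \<in> IdC_ideal N b"
    by blast
  \<comment> \<open>The coefficient of \<open>ls\<close> is isolated by letting the relation act on
    the identity and evaluating at \<open>word_inv ls\<close>; canonical words have distinct
    inverses.\<close>
  have "a ls = (if ls = ks then 1 else 0)" if ls: "ls \<in> canon N" for ls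
  proof -
    have "0 = alg_act b (fmon 1 ?r - (\<Sum>ls\<in>canon N. fmon (a ls) ls)) (indic id) (word_inv ls)"
      using alg_act_ideal [OF a] by simp
    also have "\<dots> = indic (word_inv ks) (word_inv ls) - (\<Sum>ls'\<in>canon N. a ls' * indic (word_inv ls') (word_inv ls))"
      by (simp add: alg_act_diff alg_act_sum alg_act_single word_act_canon
          word_act_reduced [OF red_word [OF w]] inv_word_perm)
    also have "(\<Sum>ls'\<in>canon N. a ls' * indic (word_inv ls') (word_inv ls)) = (\<Sum>ls'\<in>canon N. if ls' = ls then a ls else 0)"
      using word_inv_inj_on_canon [of N] ls by (intro sum.cong) (auto simp: indic_def inj_on_def)
    also have "\<dots> = a ls"
      using ls by (simp add: finite_canon)
    also have "indic (word_inv ks) (word_inv ls) = (if ls = ks then 1 else (0 :: 'a))"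
      using word_inv_inj_on_canon [of N] ls assms by (auto simp: indic_def inj_on_def)
    finally show ?thesis
      by simp
  qed
  then have "(\<Sum>ls\<in>canon N. fmon (a ls) ls) = (\<Sum>ls\<in>canon N. if ls = ks then fmon 1 ks else 0)"
    by (intro sum.cong) auto
  also have "\<dots> = fmon 1 ks"
    using assms by (simp add: finite_canon)
  finally show ?thesis
    using a by (simp add: word_cong_def)
qed

text \<open>The action forces every admissible coordinate function to have these values, which is
  the uniqueness behind the definite description. Existence is the spanning property, with canonical
  words traded for the chosen reduced words.\<close>

lemma IdC_coord_cls:
  fixes b :: "'a :: comm_ring_1"
  assumes u: "u \<in> fcarrier N" and w: "w permutes {1..N}"
  shows "IdC_coord N b (cls N b u) w = alg_act b u (indic id) (inv_into UNIV w)"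
proof -
  let ?P = "{w. w permutes {1..N}}"
  let ?s = "\<lambda>c. \<Sum>w\<in>?P. fmon (c w) (red_word N w)"
  have finP: "finite ?P"
    by (simp add: finite_permutations)
  have sum_eq: "finsum (IdC N b) (\<lambda>w. IdC_scalar N b (c w) \<otimes>\<^bsub>IdC N b\<^esub> IdC_perm N b w) ?P = cls N b (?s c)"
    for c :: "(nat \<Rightarrow> nat) \<Rightarrow> 'a"
  proof -
    interpret ring "IdC N b" by (rule IdC_ring)
    have r: "fmon a (red_word N w) \<in> fcarrier N" if "w \<in> ?P" for w and a :: 'a
      using that by (intro fcarrier_single red_word_letters) simp
    have "IdC_scalar N b (c w) \<otimes>\<^bsub>IdC N b\<^esub> IdC_perm N b w = cls N b (fmon (c w) (red_word N w))" if "w \<in> ?P" for w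
      using that r [OF that, of 1] cls_mult [OF fcarrier_fscalar, of "fmon 1 (red_word N w)" N b "c w"]
      by (simp add: IdC_perm_eq IdC_scalar_def cls_def fscalar_mult_fmon)
    then have "finsum (IdC N b) (\<lambda>w. IdC_scalar N b (c w) \<otimes>\<^bsub>IdC N b\<^esub> IdC_perm N b w) ?P
        = finsum (IdC N b) (\<lambda>w. cls N b (fmon (c w) (red_word N w))) ?P"
      by (intro finsum_cong') (simp_all add: Pi_iff cls_carrier r del: One_nat_def)
    also have "\<dots> = cls N b (?s c)"
      by (rule finsum_cls [OF finP]) (rule r)
    finally show ?thesis .
  qed
  have s_carrier: "?s c \<in> fcarrier N" for c :: "(nat \<Rightarrow> nat) \<Rightarrow> 'a"
    by (intro fcarrier_sum fcarrier_single red_word_letters) simp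
  let ?Q = "\<lambda>c :: (nat \<Rightarrow> nat) \<Rightarrow> 'a. (\<forall>w. \<not> w permutes {1..N} \<longrightarrow> c w = 0) \<and> u - ?s c \<in> IdC_ideal N b"
  have coord: "IdC_coord N b (cls N b u) = (THE c. ?Q c)"
    unfolding IdC_coord_def sum_eq cls_eq_iff [OF u s_carrier] ..
  have unique: "c w = (if w permutes {1..N} then alg_act b u (indic id) (inv_into UNIV w) else 0)" if "?Q c" for c w
  proof (cases "w permutes {1..N}")
    case True
    have "0 = alg_act b (u - ?s c) (indic id) (inv_into UNIV w)"
      using alg_act_ideal [OF conjunct2 [OF that]] by simp
    also have "\<dots> = alg_act b u (indic id) (inv_into UNIV w) -
        (\<Sum>v\<in>?P. c v * indic (inv_into UNIV v) (inv_into UNIV w))"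
      by (simp add: alg_act_diff alg_act_sum alg_act_single word_act_reduced [OF red_word])
    also have "(\<Sum>v\<in>?P. c v * indic (inv_into UNIV v) (inv_into UNIV w)) = (\<Sum>v\<in>?P. if v = w then c w else 0)"
      using True by (intro sum.cong) (auto simp: indic_def dest: arg_cong [of _ _ "inv_into UNIV"] simp: permutes_inv_inv)
    also have "\<dots> = c w"
      using True finP by simp
    finally show ?thesis
      unfolding if_P [OF True] by (metis right_minus_eq)
  qed (use that in auto)
  have "\<exists>c. ?Q c"
  proof -
    from canon_span_coeffs [OF fcarrier_canon_span [OF u]] obtain a
      where a: "u - (\<Sum>ks\<in>canon N. fmon (a ks) ks) \<in> IdC_ideal N b"
      by blast
    \<comment> \<open>Each permutation receives the coefficient of its canonical word.\<close>
    define c where "c w = (if w permutes {1..N} then a (inv_into (canon N) word_perm w) else 0)" for w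
    have inj: "inj_on word_perm (canon N)"
      using word_perm_bij_canon by (rule bij_betw_imp_inj_on)
    have "?s c = (\<Sum>ks\<in>canon N. fmon (c (word_perm ks)) (red_word N (word_perm ks)))"
      by (rule sum.reindex_bij_betw [OF word_perm_bij_canon, symmetric])
    also have "\<dots> = (\<Sum>ks\<in>canon N. fmon (a ks) (red_word N (word_perm ks)))"
      by (rule sum.cong)
        (simp_all add: c_def word_perm_permutes canon_letters inv_into_f_f [OF inj] del: One_nat_def)
    finally have "?s c - (\<Sum>ks\<in>canon N. fmon (a ks) ks)
        = (\<Sum>ks\<in>canon N. fscalar (a ks) * (fmon 1 (red_word N (word_perm ks)) - fmon 1 ks))"
      by (simp add: algebra_simps fscalar_mult_fmon sum_subtractf)
    also have "\<dots> \<in> IdC_ideal N b"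
      by (intro IdC_ideal_sum IdC_ideal_mult_left fcarrier_fscalar)
        (use word_cong_red_word in \<open>auto simp: word_cong_def\<close>)
    finally have "u - ?s c \<in> IdC_ideal N b"
      using IdC_ideal_diff [OF a, of "?s c - (\<Sum>ks\<in>canon N. fmon (a ks) ks)"]
      by (simp del: One_nat_def)
    then show ?thesis
      by (intro exI [of _ c]) (simp add: c_def)
  qed
  then obtain c0 where c0: "?Q c0"
    by blast
  have "c = c0" if "?Q c" for c
    by (rule ext) (simp only: unique [OF that] unique [OF c0])
  with c0 have "?Q (THE c. ?Q c)"
    by (rule theI [of ?Q])
  from unique [OF this, of w] show ?thesis
    unfolding coord using w by (simp only: if_True)
qed

section \<open>Double Grothendieck polynomials\<close>

definition hop :: "'a :: comm_ring_1 \<Rightarrow> nat \<Rightarrow> 'a \<Rightarrow> ((nat \<Rightarrow> nat) \<Rightarrow> 'a) \<Rightarrow> (nat \<Rightarrow> nat) \<Rightarrow> 'a" where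
  "hop b k t f p = f p + t * hecke b k f p"

text \<open>The rightmost factor acts first, so the decreasing list of \<open>j\<close> in the
  algebra product turns into a \<open>fold\<close> over increasing \<open>j\<close>. The same
  reversal makes \<open>stage\<close> apply the rows of largest index first.\<close>

definition sweep ::
  "nat \<Rightarrow> 'a :: comm_ring_1 \<Rightarrow> (nat \<Rightarrow> 'a) \<Rightarrow> nat \<Rightarrow> 'a \<Rightarrow> ((nat \<Rightarrow> nat) \<Rightarrow> 'a) \<Rightarrow> (nat \<Rightarrow> nat) \<Rightarrow> 'a"
  where "sweep N b y i t = fold (\<lambda>j. hop b (i + j - 1) (fplus b t (y j))) [1..<N - i + 1]"

definition stage ::
  "nat \<Rightarrow> 'a :: comm_ring_1 \<Rightarrow> (nat \<Rightarrow> 'a) \<Rightarrow> (nat \<Rightarrow> 'a) \<Rightarrow> nat \<Rightarrow> (nat \<Rightarrow> nat) \<Rightarrow> 'a"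
  where "stage N b x y i = foldr (\<lambda>i. sweep N b y i (x i)) [i..<N] (indic id)"

lemma alg_act_prod_list: "alg_act b (prod_list us) f = foldr (alg_act b) us f"
  by (induction us) (simp_all add: alg_act_one alg_act_mult)

lemma alg_act_h: "alg_act b (1 + fscalar t * fgen k) = hop b k t"
  by (intro ext) (simp add: hop_def alg_act_add alg_act_one alg_act_mult alg_act_fscalar alg_act_fgen)

lemma h_fcarrier: "k \<in> {1..<N} \<Longrightarrow> 1 + fscalar t * fgen k \<in> fcarrier N"
  by (intro fcarrier_add fcarrier_one fcarrier_mult fcarrier_fscalar fcarrier_fgen)

lemma IdC_h_cls: "k \<in> {1..<N} \<Longrightarrow> IdC_h N b k t = cls N b (1 + fscalar t * fgen k)"
  unfolding IdC_h_def IdC_scalar_def IdC_gen_def cls_def [symmetric]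
  by (simp only: cls_mult cls_one cls_add fcarrier_fscalar fcarrier_fgen fcarrier_mult fcarrier_one)

lemma double_groth_eq_stage:
  assumes w: "w permutes {1..N}"
  shows "double_groth N b x y w = stage N b x y 1 (inv_into UNIV w)"
proof -
  define H where "H i j = 1 + fscalar (fplus b (x i) (y j)) * fgen (i + j - 1)" for i j
  define us where "us i = map (H i) (rev [1..<N - i + 1])" for i
  have us: "u \<in> fcarrier N" if "u \<in> set (us i)" "1 \<le> i" for u i
    using that unfolding us_def H_def by (auto intro!: h_fcarrier)
  have 1: "IdC_prod N b (map (\<lambda>j. IdC_h N b (i + j - 1) (fplus b (x i) (y j))) (rev [1..<N - i + 1]))
      = cls N b (prod_list (us i))" if "1 \<le> i" for i
  proof -
    have "map (\<lambda>j. IdC_h N b (i + j - 1) (fplus b (x i) (y j))) (rev [1..<N - i + 1]) = map (cls N b) (us i)"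
      using that unfolding us_def H_def map_map by (intro map_cong) (auto intro!: IdC_h_cls)
    then show ?thesis
      using IdC_prod_cls(1) [of "us i" N b] us [of _ i] that by (simp only:)
  qed
  have "map (\<lambda>i. IdC_prod N b (map (\<lambda>j. IdC_h N b (i + j - 1) (fplus b (x i) (y j))) (rev [1..<N - i + 1]))) [1..<N]
      = map (cls N b) (map (\<lambda>i. prod_list (us i)) [1..<N])"
    unfolding map_map comp_def by (intro map_cong refl 1) simp
  moreover have "u \<in> fcarrier N" if "u \<in> set (map (\<lambda>i. prod_list (us i)) [1..<N])" for u
    using that us IdC_prod_cls(2) by fastforce
  ultimately have "double_groth N b x y w
      = IdC_coord N b (cls N b (prod_list (map (\<lambda>i. prod_list (us i)) [1..<N]))) w"
    "prod_list (map (\<lambda>i. prod_list (us i)) [1..<N]) \<in> fcarrier N"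
    unfolding double_groth_def using IdC_prod_cls(1) [of "map (\<lambda>i. prod_list (us i)) [1..<N]" N b]
      IdC_prod_cls(2) [of "map (\<lambda>i. prod_list (us i)) [1..<N]" N]
    by (simp_all only:)
  moreover have "alg_act b (prod_list (us i)) = sweep N b y i (x i)" for i
  proof (rule ext)
    fix f
    have "alg_act b \<circ> H i = (\<lambda>j. hop b (i + j - 1) (fplus b (x i) (y j)))"
      by (rule ext) (simp add: H_def alg_act_h)
    then show "alg_act b (prod_list (us i)) f = sweep N b y i (x i) f"
      unfolding us_def sweep_def alg_act_prod_list foldr_conv_fold rev_map rev_rev_ident fold_map
        by (simp only:)
  qed
  then have "alg_act b (prod_list (map (\<lambda>i. prod_list (us i)) [1..<N])) (indic id) = stage N b x y 1"
    by (simp add: alg_act_prod_list stage_def foldr_map comp_def del: upt_Suc One_nat_def)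
  ultimately show ?thesis
    using IdC_coord_cls [OF _ w, of "prod_list (map (\<lambda>i. prod_list (us i)) [1..<N])" b]
    by (simp only:)
qed

text \<open>Since x \<oplus> 0 = x, only the indices of the factors have to be matched, by k = i + j
  - 1.\<close>

lemma groth_eq_double_groth: "groth N b x = double_groth N b x (\<lambda>_. 0)"
proof -
  have "IdC_A N b i (x i)
      = IdC_prod N b (map (\<lambda>j. IdC_h N b (i + j - 1) (fplus b (x i) 0)) (rev [1..<N - i + 1]))"
    if "i \<in> set [1..<N]" for i
  proof -
    have "[i..<N] = map (\<lambda>j. i + j - 1) [1..<N - i + 1]"
      by (rule nth_equalityI) (use that in \<open>auto simp del: upt_Suc\<close>)
    then have "rev [i..<N] = map (\<lambda>j. i + j - 1) (rev [1..<N - i + 1])"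
      by (simp only: rev_map)
    then show ?thesis
      unfolding IdC_A_def by (simp only: map_map comp_def fplus_def mult_zero_right add_0_right)
  qed
  then have "map (\<lambda>i. IdC_A N b i (x i)) [1..<N] = map (\<lambda>i. IdC_prod N b
      (map (\<lambda>j. IdC_h N b (i + j - 1) (fplus b (x i) 0)) (rev [1..<N - i + 1]))) [1..<N]"
    by (rule map_cong [OF refl])
  then show ?thesis
    unfolding groth_def double_groth_def by (simp only:)
qed

section \<open>Grassmannian permutations and sets of positions\<close>

definition lower :: "nat set \<Rightarrow> nat \<Rightarrow> nat" where
  "lower S k = card {s \<in> S. s \<le> k}"

definition upper :: "nat set \<Rightarrow> nat \<Rightarrow> nat" where
  "upper S k = card {s \<in> S. k < s}"

text \<open>The inverse of the Grassmannian permutation that takes its first values in \<open>S\<close>.\<close>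

definition pos_perm :: "nat set \<Rightarrow> nat \<Rightarrow> nat" where
  "pos_perm S k = (if k \<in> S then lower S k else if k = 0 then 0 else k + upper S k)"

lemma lower_Suc: "finite S \<Longrightarrow> lower S (Suc k) = lower S k + (if Suc k \<in> S then 1 else 0)"
proof -
  assume S: "finite S"
  have "{s \<in> S. s \<le> Suc k} = (if Suc k \<in> S then insert (Suc k) {s \<in> S. s \<le> k} else {s \<in> S. s \<le> k})"
    by (auto simp: le_Suc_eq)
  then show ?thesis
    using S by (simp add: lower_def)
qed

lemma lower_add_upper: "finite S \<Longrightarrow> lower S k + upper S k = card S"
proof -
  assume S: "finite S"
  have "{s \<in> S. s \<le> k} \<union> {s \<in> S. k < s} = S"
    by auto
  moreover have "card ({s \<in> S. s \<le> k} \<union> {s \<in> S. k < s}) = lower S k + upper S k"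
    unfolding lower_def upper_def using S by (intro card_Un_disjoint) auto
  ultimately show ?thesis
    by simp
qed

lemma lower_le:
  assumes "0 \<notin> S"
  shows "lower S k \<le> k"
proof -
  have "{s \<in> S. s \<le> k} \<subseteq> {1..k}"
  proof
    fix s assume "s \<in> {s \<in> S. s \<le> k}"
    then have s: "s \<in> S" "s \<le> k"
      by simp_all
    then have "s \<noteq> 0"
      using assms by metis
    with s show "s \<in> {1..k}"
      by simp
  qed
  then have "lower S k \<le> card {1..k}"
    unfolding lower_def by (intro card_mono) auto
  then show ?thesis
    by simp
qed

lemma lower_less:
  assumes "0 \<notin> S" "k \<notin> S" "1 \<le> k"
  shows "lower S k < k"
proof -
  have "{s \<in> S. s \<le> k} \<subseteq> {1..<k}"
  proof
    fix s assume "s \<in> {s \<in> S. s \<le> k}"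
    then have s: "s \<in> S" "s \<le> k"
      by simp_all
    then have "s \<noteq> 0" "s \<noteq> k"
      using assms by metis+
    with s show "s \<in> {1..<k}"
      by simp
  qed
  then have "lower S k \<le> card {1..<k}"
    unfolding lower_def by (intro card_mono) auto
  then show ?thesis
    using assms(3) by simp
qed

section \<open>Descents and permutation properties of \<open>pos_perm\<close>\<close>

context
  fixes S :: "nat set"
  assumes S: "finite S" "0 \<notin> S"
begin

lemma pos_perm_nonmember: "k \<notin> S \<Longrightarrow> 1 \<le> k \<Longrightarrow> pos_perm S k + lower S k = k + card S"
  using lower_add_upper [OF S(1), of k] by (simp add: pos_perm_def)

text \<open>The values increase along \<open>S\<close> and along its complement, and members of
  \<open>S\<close> get the smaller values, so a descent can only lead from a nonmember to a
  member.\<close>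

lemma pos_perm_descent:
  assumes "1 \<le> k"
  shows "pos_perm S (Suc k) < pos_perm S k \<longleftrightarrow> k \<notin> S \<and> Suc k \<in> S"
proof -
  note * = lower_add_upper [OF S(1), of k] lower_add_upper [OF S(1), of "Suc k"] lower_Suc [OF S(1), of k]
    lower_le [OF S(2), of k]
  consider "k \<in> S" | "k \<notin> S" "Suc k \<in> S" | "k \<notin> S" "Suc k \<notin> S"
    by blast
  then show ?thesis
  proof cases
    case 1
    then show ?thesis
      using * by (cases "Suc k \<in> S") (simp_all add: pos_perm_def)
  next
    case 2
    then show ?thesis
      using * assms lower_less [OF S(2) 2(1) assms] by (simp add: pos_perm_def)
  next
    case 3
    then show ?thesis
      using * assms by (simp add: pos_perm_def)
  qed
qed

text \<open>Moving an element from \<open>Suc k\<close> to \<open>k\<close> alters the counts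
  \<open>lower\<close> and \<open>upper\<close> at the threshold \<open>k\<close> only.\<close>

lemma pos_perm_adj:
  assumes "1 \<le> k" "k \<notin> S" "Suc k \<in> S"
  shows "pos_perm S \<circ> adj k = pos_perm (adj k ` S)"
proof (rule ext)
  fix j
  have inj: "inj_on (adj k) A" for A
    by (metis inj_onI transpose_involutory)
  have low: "lower (adj k ` S) j = lower S j" and up: "upper (adj k ` S) j = upper S j" if "j \<noteq> k" for j
  proof -
    have "{s \<in> adj k ` S. s \<le> j} = adj k ` {s \<in> S. s \<le> j}" "{s \<in> adj k ` S. j < s} = adj k ` {s \<in> S. j < s}"
      using that by (auto simp: Transposition.transpose_def split: if_splits)
    then show "lower (adj k ` S) j = lower S j" "upper (adj k ` S) j = upper S j"
      by (simp_all add: lower_def upper_def card_image [OF inj])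
  qed
  have mem: "j \<in> adj k ` S \<longleftrightarrow> adj k j \<in> S" for j
    by (metis image_iff transpose_involutory)
  have fin: "finite (adj k ` S)"
    using S by simp
  have card: "card (adj k ` S) = card S"
    by (rule card_image [OF inj])
  consider "j = k" | "j = Suc k" | "j \<noteq> k" "j \<noteq> Suc k"
    by blast
  then show "(pos_perm S \<circ> adj k) j = pos_perm (adj k ` S) j"
  proof cases
    case 1
    have "k \<in> adj k ` S" "Suc k \<notin> adj k ` S"
      using assms by (simp_all add: mem)
    then have "lower (adj k ` S) k = lower S (Suc k)"
      using lower_Suc [OF fin, of k] low [of "Suc k"] by simp
    with 1 assms mem [of k] show ?thesis
      by (simp add: pos_perm_def)
  next
    case 2
    have "upper S k = Suc (upper S (Suc k))"
      using lower_add_upper [OF S(1), of k] lower_add_upper [OF S(1), of "Suc k"] lower_Suc [OF S(1), of k] assms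
      by simp
    with 2 assms mem [of "Suc k"] up [of "Suc k"] show ?thesis
      by (simp add: pos_perm_def)
  next
    case 3
    then have "adj k j = j"
      by (simp add: Transposition.transpose_def)
    with 3 mem [of j] low [of j] up [of j] show ?thesis
      by (simp add: pos_perm_def)
  qed
qed

text \<open>The coordinates at Grassmannian permutations form a closed system: the operator refers
  to no other coordinates.\<close>

lemma hop_pos_perm:
  assumes "1 \<le> k"
  shows "hop b k t f (pos_perm S) = f (pos_perm S) +
    (if k \<notin> S \<and> Suc k \<in> S then t * (f (pos_perm (adj k ` S)) + b * f (pos_perm S)) else 0)"
  using assms by (simp add: hop_def hecke_def pos_perm_descent pos_perm_adj)

lemma pos_perm_member_le: "pos_perm S k \<le> card S" if "k \<in> S"
  using that S lower_add_upper [OF S(1), of k] by (simp add: pos_perm_def)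

lemma pos_perm_nonmember_gt: "card S < pos_perm S k" if "k \<notin> S" "1 \<le> k"
  using pos_perm_nonmember [OF that] lower_less [OF S(2) that] by linarith

lemma pos_perm_nonmember_mono:
  assumes "k \<notin> S" "l \<notin> S" "1 \<le> k" "k < l"
  shows "pos_perm S k < pos_perm S l"
proof -
  have "{s \<in> S. s \<le> l} \<subseteq> {s \<in> S. s \<le> k} \<union> {k<..<l}"
    using assms by (auto simp: nat_less_le)
  then have "lower S l \<le> card ({s \<in> S. s \<le> k} \<union> {k<..<l})"
    unfolding lower_def using S by (intro card_mono) auto
  also have "\<dots> \<le> lower S k + (l - Suc k)"
    unfolding lower_def using card_Un_le [of "{s \<in> S. s \<le> k}" "{k<..<l}"] by simp
  finally show ?thesis
    using pos_perm_nonmember [of k] pos_perm_nonmember [of l] assms by simp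
qed

lemma pos_perm_member_mono:
  assumes "k \<in> S" "l \<in> S" "k < l"
  shows "pos_perm S k < pos_perm S l"
proof -
  have "l \<in> {s \<in> S. s \<le> l} - {s \<in> S. s \<le> k}"
    using assms by simp
  moreover have "{s \<in> S. s \<le> k} \<subseteq> {s \<in> S. s \<le> l}"
    using assms by auto
  ultimately have "{s \<in> S. s \<le> k} \<subset> {s \<in> S. s \<le> l}"
    by blast
  then have "lower S k < lower S l"
    unfolding lower_def using S by (intro psubset_card_mono) auto
  with assms show ?thesis
    by (simp add: pos_perm_def)
qed

lemma pos_perm_permutes:
  assumes "S \<subseteq> {1..N}"
  shows "pos_perm S permutes {1..N}"
proof (rule bij_imp_permutes)
  have inj: "inj_on (pos_perm S) {1..N}"
  proof (rule linorder_inj_onI)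
    fix k l :: nat assume "k < l" "k \<in> {1..N}" "l \<in> {1..N}"
    then show "pos_perm S k \<noteq> pos_perm S l"
      using pos_perm_nonmember_mono [of k l] pos_perm_member_mono [of k l]
        pos_perm_member_le [of k] pos_perm_member_le [of l] pos_perm_nonmember_gt [of k] pos_perm_nonmember_gt [of l]
      by (cases "k \<in> S"; cases "l \<in> S") auto
  qed auto
  have "pos_perm S k \<in> {1..N}" if k: "k \<in> {1..N}" for k
  proof (cases "k \<in> S")
    case True
    then have "lower S k > 0"
      unfolding lower_def using S by (auto simp: card_gt_0_iff)
    moreover have "lower S k \<le> k"
      by (rule lower_le [OF S(2)])
    ultimately show ?thesis
      using k True by (simp add: pos_perm_def)
  next
    case False
    have "{s \<in> S. k < s} \<subseteq> {k<..N}"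
      using assms by auto
    then have "upper S k \<le> N - k"
      unfolding upper_def using card_mono [of "{k<..N}"] by fastforce
    then show ?thesis
      using k False by (auto simp: pos_perm_def)
  qed
  then have "pos_perm S ` {1..N} \<subseteq> {1..N}"
    by blast
  then show "bij_betw (pos_perm S) {1..N} {1..N}"
    using inj endo_inj_surj [of "{1..N}" "pos_perm S"] by (simp add: bij_betw_def)
  fix k assume k: "k \<notin> {1..N}"
  show "pos_perm S k = k"
  proof (cases "k = 0")
    case True
    then show ?thesis
      using S by (simp add: pos_perm_def)
  next
    case False
    with k assms have "k \<notin> S" "{s \<in> S. k < s} = {}"
      by auto
    then have "upper S k = 0"
      unfolding upper_def by (simp only: card.empty)
    with False \<open>k \<notin> S\<close> show ?thesis
      by (simp add: pos_perm_def)
  qed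
qed

end

section \<open>From partitions to decreasing positions\<close>

lemma strict_antimono_inj_on:
  fixes d :: "nat \<Rightarrow> nat"
  assumes "strict_antimono_on A d"
  shows "inj_on d A"
proof (rule inj_onI)
  fix i j assume "i \<in> A" "j \<in> A" "d i = d j"
  then show "i = j"
    using monotone_onD [OF assms, of i j] monotone_onD [OF assms, of j i] by (cases i j rule: linorder_cases) auto
qed

lemma pos_perm_decreasing:
  assumes "strict_antimono_on {..<n} d" "c < n"
  shows "pos_perm (d ` {..<n}) (d c) = n - c"
proof -
  have less: "d j < d i" if "i < j" "j < n" for i j
    using monotone_onD [OF assms(1), of i j] that by simp
  have inj: "inj_on d {..<n}"
    by (rule strict_antimono_inj_on [OF assms(1)])
  have "{s \<in> d ` {..<n}. s \<le> d c} = d ` {c..<n}"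
  proof (intro equalityI subsetI)
    fix s assume "s \<in> {s \<in> d ` {..<n}. s \<le> d c}"
    then obtain i where "i < n" "s = d i" "d i \<le> d c"
      by auto
    then show "s \<in> d ` {c..<n}"
      using less [of i c] assms(2) by (cases "i < c") auto
  next
    fix s assume "s \<in> d ` {c..<n}"
    then obtain i where "c \<le> i" "i < n" "s = d i"
      by auto
    then show "s \<in> {s \<in> d ` {..<n}. s \<le> d c}"
      using less [of c i] by (cases "i = c") auto
  qed
  moreover have "card (d ` {c..<n}) = n - c"
    by (subst card_image) (auto intro: inj_on_subset [OF inj])
  ultimately show ?thesis
    using assms(2) by (simp add: pos_perm_def lower_def)
qed

lemma strict_mono_on_image_unique:
  fixes f g :: "nat \<Rightarrow> nat"
  assumes "strict_mono_on A f" "strict_mono_on A g" "f ` A = g ` A" "a \<in> A"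
  shows "f a = g a"
  using assms(4)
proof (induction a rule: less_induct)
  case (less a)
  have "\<not> f a < g a" if f: "strict_mono_on A f" and g: "strict_mono_on A g" and im: "f ` A = g ` A"
    and IH: "\<And>a'. a' < a \<Longrightarrow> a' \<in> A \<Longrightarrow> f a' = g a'" for f g :: "nat \<Rightarrow> nat"
  proof
    assume lt: "f a < g a"
    from im less.prems obtain a' where a': "a' \<in> A" "f a = g a'"
      by (metis imageE imageI)
    have "a' < a"
    proof (rule ccontr)
      assume "\<not> a' < a"
      then have "g a \<le> g a'"
        using strict_mono_onD [OF g less.prems a'(1)] by (cases "a = a'") (simp_all add: less_imp_le)
      with lt a' show False
        by simp
    qed
    with IH [of a'] a' have "f a' = f a"
      by simp
    moreover have "f a' < f a"
      using strict_mono_onD [OF f a'(1) less.prems] \<open>a' < a\<close> by simp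
    ultimately show False
      by simp
  qed
  from this [OF assms(1-3) less.IH] this [OF assms(2,1) assms(3) [symmetric]] less.IH show ?case
    by (metis linorder_neqE_nat)
qed

text \<open>With the 0-based index \<open>c = n - i\<close>, the prescribed value at
  \<open>i\<close> is \<open>d c\<close>. The shift by \<open>n - c\<close> makes the weakly
  decreasing parts strictly decreasing, so that they can serve as distinct positions.\<close>

lemma grassmannian_inverse:
  assumes n: "1 \<le> n" and lam: "\<And>i j. 1 \<le> i \<Longrightarrow> i \<le> j \<Longrightarrow> j \<le> n \<Longrightarrow> lam j \<le> lam i" and N: "n + lam 1 \<le> N"
  defines "d \<equiv> \<lambda>c. lam (c + 1) + n - c"
  shows "grassmannian N n lam permutes {1..N}"
    and "inv_into UNIV (grassmannian N n lam) = pos_perm (d ` {..<n})"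
    and "strict_antimono_on {..<n} d" and "d ` {..<n} \<subseteq> {1..N}"
proof -
  let ?S = "d ` {..<n}"
  have less: "d j < d i" if "i < j" "j < n" for i j
    using lam [of "i + 1" "j + 1"] that by (simp add: d_def)
  then show anti: "strict_antimono_on {..<n} d"
    by (auto intro!: monotone_onI)
  have "d c \<in> {1..N}" if "c < n" for c
    using lam [of 1 "c + 1"] that N by (auto simp: d_def)
  then show sub: "?S \<subseteq> {1..N}"
    by auto
  have S: "finite ?S" "0 \<notin> ?S"
    using sub by auto
  have "inj_on d {..<n}"
    by (rule strict_antimono_inj_on [OF anti])
  then have cardS: "card ?S = n"
    by (simp add: card_image)
  let ?p = "pos_perm ?S"
  have perm: "?p permutes {1..N}"
    by (rule pos_perm_permutes [OF S sub])
  let ?Q = "\<lambda>s. s permutes {1..N} \<and> (\<forall>i\<in>{1..n}. s i = i + lam (n + 1 - i)) \<and> strict_mono_on {n + 1..N} s"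
  have ex: "?Q (inv_into UNIV ?p)"
  proof (intro conjI ballI)
    show "inv_into UNIV ?p permutes {1..N}"
      by (rule permutes_inv [OF perm])
    fix i assume i: "i \<in> {1..n}"
    have "?p (d (n - i)) = i"
      using pos_perm_decreasing [OF anti, of "n - i"] i n by auto
    moreover have "d (n - i) = i + lam (n + 1 - i)"
      using i by (simp add: d_def Suc_diff_le)
    ultimately show "inv_into UNIV ?p i = i + lam (n + 1 - i)"
      using permutes_inverses(2) [OF perm] by metis
  next
    show "strict_mono_on {n + 1..N} (inv_into UNIV ?p)"
    proof (rule strict_mono_onI)
      fix a b assume ab: "a \<in> {n + 1..N}" "b \<in> {n + 1..N}" "a < b"
      have *: "inv_into UNIV ?p a \<notin> ?S \<and> 1 \<le> inv_into UNIV ?p a" if "a \<in> {n + 1..N}" for a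
        using pos_perm_member_le [OF S, of "inv_into UNIV ?p a"] permutes_inverses(1) [OF perm, of a] that
          permutes_in_image [OF permutes_inv [OF perm], of a] cardS by auto
      show "inv_into UNIV ?p a < inv_into UNIV ?p b"
      proof (rule ccontr)
        assume "\<not> ?thesis"
        then have "b \<le> a"
          using pos_perm_nonmember_mono [OF S, of "inv_into UNIV ?p b" "inv_into UNIV ?p a"] * [OF ab(1)] * [OF ab(2)]
            permutes_inverses(1) [OF perm, of a] permutes_inverses(1) [OF perm, of b]
          by (metis less_or_eq_imp_le linorder_neqE_nat)
        with ab show False
          by simp
      qed
    qed
  qed
  \<comment> \<open>The prescribed values determine the set of the remaining ones, and an increasing
    enumeration of a set is unique.\<close>
  have uniq: "s = s'" if s: "?Q s" and s': "?Q s'" for s s'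
  proof (rule ext)
    fix k
    have split: "{n + 1..N} = {1..N} - {1..n}"
      by auto
    have im: "r ` {n + 1..N} = {1..N} - r ` {1..n}" if "r permutes {1..N}" for r
      unfolding split by (subst image_set_diff) (use permutes_inj [OF that] permutes_image [OF that] in \<open>auto simp del: One_nat_def\<close>)
    have "s ` {1..n} = s' ` {1..n}"
      using s s' by (intro image_cong) auto
    then have im_eq: "s ` {n + 1..N} = s' ` {n + 1..N}"
      using im s s' by metis
    consider "k \<in> {1..n}" | "k \<in> {n + 1..N}" | "k \<notin> {1..N}"
      by fastforce
    then show "s k = s' k"
    proof cases
      case 1
      then show ?thesis
        using s s' by metis
    next
      case 2
      then show ?thesis
        using s s' im_eq by (intro strict_mono_on_image_unique [of "{n + 1..N}"]) blast+
    next
      case 3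
      then show ?thesis
        using s s' by (metis permutes_not_in)
    qed
  qed
  have "grassmannian N n lam = inv_into UNIV ?p"
    unfolding grassmannian_def using ex uniq by (intro the_equality) blast+
  then show "grassmannian N n lam permutes {1..N}" "inv_into UNIV (grassmannian N n lam) = ?p"
    using permutes_inv [OF perm] permutes_inv_inv [OF perm] by simp_all
qed

section \<open>Determinants\<close>

lemma det_mat_cong:
  assumes "\<And>r c. r < m \<Longrightarrow> c < m \<Longrightarrow> f r c = g r c"
  shows "det (mat m m (\<lambda>(r, c). f r c)) = det (mat m m (\<lambda>(r, c). g r c))"
  by (intro arg_cong [of _ _ det] cong_mat refl) (use assms in auto)

lemma det_mat_row_scale:
  fixes f :: "nat \<Rightarrow> nat \<Rightarrow> 'a :: comm_ring_1"
  shows "det (mat m m (\<lambda>(r, c). s r * f r c)) = (\<Prod>r<m. s r) * det (mat m m (\<lambda>(r, c). f r c))"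
proof -
  have "det (mat m m (\<lambda>(r, c). s r * f r c))
      = (\<Sum>p | p permutes {0..<m}. signof p * (\<Prod>i = 0..<m. s i * f i (p i)))"
    by (subst det_def' [of _ m]) (auto intro!: sum.cong prod.cong simp: permutes_in_image)
  also have "\<dots> = (\<Prod>r<m. s r) * (\<Sum>p | p permutes {0..<m}. signof p * (\<Prod>i = 0..<m. f i (p i)))"
    by (simp add: prod.distrib sum_distrib_left mult_ac atLeast0LessThan)
  also have "(\<Sum>p | p permutes {0..<m}. signof p * (\<Prod>i = 0..<m. f i (p i))) = det (mat m m (\<lambda>(r, c). f r c))"
    by (subst det_def' [of _ m]) (auto intro!: sum.cong prod.cong simp: permutes_in_image)
  finally show ?thesis .
qed

text \<open>The cofactors along column \<open>c0\<close> do not see that column, so one Laplace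
  expansion gives linearity.\<close>

lemma det_mat_column_linear:
  fixes f g h :: "nat \<Rightarrow> nat \<Rightarrow> 'a :: comm_ring_1"
  assumes c0: "c0 < m"
    and eq: "\<And>r c. r < m \<Longrightarrow> c < m \<Longrightarrow> c \<noteq> c0 \<Longrightarrow> f r c = g r c \<and> f r c = h r c"
    and lin: "\<And>r. r < m \<Longrightarrow> f r c0 = p * g r c0 + q * h r c0"
  shows "det (mat m m (\<lambda>(r, c). f r c))
    = p * det (mat m m (\<lambda>(r, c). g r c)) + q * det (mat m m (\<lambda>(r, c). h r c))"
proof -
  let ?M = "\<lambda>f. mat m m (\<lambda>(r, c). f r c)"
  have cof: "cofactor (?M f) i c0 = cofactor (?M k) i c0"
    if "\<And>r c. r < m \<Longrightarrow> c < m \<Longrightarrow> c \<noteq> c0 \<Longrightarrow> f r c = k r c" "i < m" for k i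
  proof -
    have "mat_delete (?M f) i c0 = mat_delete (?M k) i c0"
      by (rule eq_matI) (use that c0 in \<open>auto simp: mat_delete_def\<close>)
    then show ?thesis
      by (simp add: cofactor_def)
  qed
  have "det (?M k) = (\<Sum>i<m. k i c0 * cofactor (?M k) i c0)" for k :: "nat \<Rightarrow> nat \<Rightarrow> 'a"
    using laplace_expansion_column [of "?M k" m c0] c0 by simp
  moreover have "cofactor (?M g) i c0 = cofactor (?M f) i c0" "cofactor (?M h) i c0 = cofactor (?M f) i c0"
    if "i < m" for i
    using eq that by (intro cof [symmetric]; blast)+
  ultimately show ?thesis
    using lin by (simp add: sum_distrib_left sum.distrib [symmetric] algebra_simps)
qed

text \<open>Right multiplication by the lower bidiagonal matrix \<open>T\<close> replaces column
  \<open>c < m\<close> by \<open>Z c\<close> times its right neighbour minus \<open>u\<close> times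
  itself. This clears row 0 up to its last entry, along which the determinant is expanded. The
  factor \<open>(- u) ^ m\<close> is det T; keeping it avoids a division.\<close>

lemma det_mat_eliminate_row:
  fixes G :: "nat \<Rightarrow> nat \<Rightarrow> 'a :: comm_ring_1"
  assumes row: "\<And>c. c < m \<Longrightarrow> G 0 (Suc c) * Z c = u * G 0 c"
  shows "(- u) ^ m * det (mat (Suc m) (Suc m) (\<lambda>(r, c). G r c))
    = (- 1) ^ m * G 0 m * det (mat m m (\<lambda>(r, c). G (Suc r) (Suc c) * Z c - u * G (Suc r) c))"
proof -
  let ?n = "Suc m"
  define A where "A = mat ?n ?n (\<lambda>(r, c). G r c)"
  define t where "t i c = (if c < m then if i = c then - u else if i = Suc c then Z c else 0
    else if i = m then 1 else 0)" for i c
  define T where "T = mat ?n ?n (\<lambda>(i, c). t i c)"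
  have A: "A \<in> carrier_mat ?n ?n" and T: "T \<in> carrier_mat ?n ?n"
    by (simp_all add: A_def T_def)
  have detT: "det T = (- u) ^ m"
  proof -
    have "det T = prod_list (diag_mat T)"
      by (rule det_lower_triangular [OF _ T]) (auto simp: T_def t_def)
    also have "\<dots> = (\<Prod>i<?n. T $$ (i, i))"
      by (simp add: prod_list_diag_prod T_def atLeast0LessThan)
    also have "\<dots> = (\<Prod>i<m. - u) * 1"
      by (simp add: T_def t_def)
    finally show ?thesis
      by simp
  qed
  have AT: "(A * T) $$ (r, c) = (if c < m then G r (Suc c) * Z c - u * G r c else G r m)" if "r < ?n" "c < ?n" for r c
  proof -
    have "(A * T) $$ (r, c) = (\<Sum>i<?n. G r i * t i c)"
      using that by (simp add: A_def T_def scalar_prod_def atLeast0LessThan)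
    also have "\<dots> = (if c < m then G r (Suc c) * Z c - u * G r c else G r m)"
    proof (cases "c < m")
      case True
      have "(\<Sum>i<?n. G r i * t i c) = (\<Sum>i\<in>{c, Suc c}. G r i * t i c)"
        by (rule sum.mono_neutral_right) (use True in \<open>auto simp: t_def\<close>)
      then show ?thesis
        using True by (simp add: t_def algebra_simps)
    next
      case False
      have "(\<Sum>i<?n. G r i * t i c) = (\<Sum>i\<in>{m}. G r i * t i c)"
        by (rule sum.mono_neutral_right) (use False in \<open>auto simp: t_def\<close>)
      then show ?thesis
        using False by (simp add: t_def)
    qed
    finally show ?thesis .
  qed
  have "det (A * T) = (\<Sum>j<?n. (A * T) $$ (0, j) * cofactor (A * T) 0 j)"
    by (rule laplace_expansion_row) (use A T in auto)
  also have "\<dots> = (\<Sum>j\<in>{m}. (A * T) $$ (0, j) * cofactor (A * T) 0 j)"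
    by (rule sum.mono_neutral_right) (auto simp: AT row less_Suc_eq)
  also have "\<dots> = G 0 m * ((- 1) ^ m * det (mat_delete (A * T) 0 m))"
    by (simp add: AT cofactor_def)
  also have "mat_delete (A * T) 0 m = mat m m (\<lambda>(r, c). G (Suc r) (Suc c) * Z c - u * G (Suc r) c)"
    using A T by (intro eq_matI) (auto simp: mat_delete_def AT simp del: index_mult_mat(1))
  finally have "det A * det T = (- 1) ^ m * G 0 m
      * det (mat m m (\<lambda>(r, c). G (Suc r) (Suc c) * Z c - u * G (Suc r) c))"
    by (simp add: det_mult [OF A T] mult_ac)
  then show ?thesis
    by (simp add: detT A_def mult.commute)
qed

section \<open>Sweeping particles to the right\<close>

text \<open>The factorial power with q - 1 factors: the argument is a position, and a particle that
  has come from 1 to q has made q - 1 steps.\<close>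

definition ypow :: "'a :: comm_ring_1 \<Rightarrow> (nat \<Rightarrow> 'a) \<Rightarrow> nat \<Rightarrow> 'a \<Rightarrow> 'a" where
  "ypow b y q t = (\<Prod>l = 1..<q. fplus b t (y l))"

lemma ypow_one [simp]: "ypow b y (Suc 0) t = 1"
  by (simp add: ypow_def)

lemma ypow_Suc: "1 \<le> q \<Longrightarrow> ypow b y (Suc q) t = ypow b y q t * fplus b t (y q)"
  by (simp add: ypow_def)

text \<open>The particles are numbered from right to left, starting with 0.\<close>

definition positions :: "nat \<Rightarrow> nat \<Rightarrow> (nat \<Rightarrow> nat) \<Rightarrow> bool" where
  "positions N n d \<longleftrightarrow> strict_antimono_on {..<n} d \<and> d ` {..<n} \<subseteq> {1..N}"

text \<open>The particles from number \<open>m\<close> on have not been released: they sit where the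
  identity permutation puts them.\<close>

definition ground :: "nat \<Rightarrow> nat \<Rightarrow> (nat \<Rightarrow> nat) \<Rightarrow> bool" where
  "ground n m d \<longleftrightarrow> (\<forall>j. m \<le> j \<and> j < n \<longrightarrow> d j = n - j)"

lemma positions_less: "positions N n d \<Longrightarrow> i < j \<Longrightarrow> j < n \<Longrightarrow> d j < d i"
  unfolding positions_def using monotone_onD [of "{..<n}" "(<)" "(>)" d i j] by simp

lemma positions_bounds: "positions N n d \<Longrightarrow> j < n \<Longrightarrow> 1 \<le> d j \<and> d j \<le> N"
  unfolding positions_def by auto

lemma positions_set: "positions N n d \<Longrightarrow> finite (d ` {..<n}) \<and> 0 \<notin> d ` {..<n}"
  unfolding positions_def by auto

lemma positions_ge: "positions N n d \<Longrightarrow> j < n \<Longrightarrow> n - j \<le> d j"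
proof (induction "n - j" arbitrary: j)
  case (Suc i)
  show ?case
  proof (cases "Suc j < n")
    case True
    then have "n - Suc j \<le> d (Suc j)"
      using Suc by auto
    moreover have "d (Suc j) < d j"
      using positions_less [OF Suc.prems(1), of j "Suc j"] True by simp
    ultimately show ?thesis
      by linarith
  next
    case False
    then show ?thesis
      using positions_bounds [OF Suc.prems] Suc.prems by auto
  qed
qed simp

text \<open>A new coordinate is computed from the configuration before the move, hence the particle
  is put back from \<open>Suc k\<close> to \<open>k\<close>. The order survives because
  \<open>k\<close> is free.\<close>

lemma positions_step:
  assumes d: "positions N n d" and k: "1 \<le> k" "k \<notin> d ` {..<n}" and c: "c < n" "d c = Suc k"
  shows "positions N n (d(c := k))" and "(d(c := k)) ` {..<n} = adj k ` d ` {..<n}"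
proof -
  have ne: "d j \<noteq> k" if "j < n" for j
    using that k by auto
  have "strict_antimono_on {..<n} (d(c := k))"
  proof (intro monotone_onI)
    fix i j assume ij: "i \<in> {..<n}" "j \<in> {..<n}" "i < j"
    then show "(d(c := k)) i > (d(c := k)) j"
      using positions_less [OF d, of i j] ne [of i] ne [of j] c by auto
  qed
  moreover have "k \<le> N"
    using positions_bounds [OF d c(1)] c(2) by simp
  ultimately show "positions N n (d(c := k))"
    using d k unfolding positions_def by (auto simp: fun_upd_def)
  have "(d(c := k)) j = adj k (d j)" if "j < n" for j
  proof (cases "j = c")
    case True
    then show ?thesis
      using c by simp
  next
    case False
    then have "d j \<noteq> Suc k"
      using positions_less [OF d, of j c] positions_less [OF d, of c j] c that
      by (cases j c rule: linorder_cases) auto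
    with ne [OF that] False show ?thesis
      by (simp add: Transposition.transpose_def)
  qed
  then show "(d(c := k)) ` {..<n} = adj k ` d ` {..<n}"
    unfolding image_image by (intro image_cong) auto
qed

lemma hop_positions:
  assumes d: "positions N n d" and k: "1 \<le> k"
  shows "Suc k \<notin> d ` {..<n} \<Longrightarrow> hop b k t f (pos_perm (d ` {..<n})) = f (pos_perm (d ` {..<n}))"
    and "k \<in> d ` {..<n} \<Longrightarrow> hop b k t f (pos_perm (d ` {..<n})) = f (pos_perm (d ` {..<n}))"
    and "k \<notin> d ` {..<n} \<Longrightarrow> c < n \<Longrightarrow> d c = Suc k \<Longrightarrow> hop b k t f (pos_perm (d ` {..<n}))
      = (1 + b * t) * f (pos_perm (d ` {..<n})) + t * f (pos_perm ((d(c := k)) ` {..<n}))"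
proof -
  note hp = hop_pos_perm [OF conjunct1 [OF positions_set [OF d]] conjunct2 [OF positions_set [OF d]] k]
  show "Suc k \<notin> d ` {..<n} \<Longrightarrow> hop b k t f (pos_perm (d ` {..<n})) = f (pos_perm (d ` {..<n}))"
    and "k \<in> d ` {..<n} \<Longrightarrow> hop b k t f (pos_perm (d ` {..<n})) = f (pos_perm (d ` {..<n}))"
    unfolding hp by simp_all
  assume c: "k \<notin> d ` {..<n}" "c < n" "d c = Suc k"
  then have "Suc k \<in> d ` {..<n}"
    by (metis imageI lessThan_iff)
  then show "hop b k t f (pos_perm (d ` {..<n}))
      = (1 + b * t) * f (pos_perm (d ` {..<n})) + t * f (pos_perm ((d(c := k)) ` {..<n}))"
    unfolding hp positions_step(2) [OF d k c] using c(1) by (simp add: algebra_simps del: fun_upd_apply)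
qed

text \<open>Here \<open>x\<close> is the variable of the current row and \<open>t\<close> an older
  one. The first branch is the column that \<open>det_mat_eliminate_row\<close> produces, with
  \<open>u = 1 + b * x\<close> and \<open>Z\<close> the product over the gap between particles
  \<open>c\<close> and \<open>Suc c\<close>. The second is the column of the previous stage, whose
  positions are counted from \<open>Suc a\<close>, times \<open>x - t\<close>.\<close>

definition sweep_entry ::
  "'a :: comm_ring_1 \<Rightarrow> (nat \<Rightarrow> 'a) \<Rightarrow> 'a \<Rightarrow> nat \<Rightarrow> nat \<Rightarrow> (nat \<Rightarrow> nat) \<Rightarrow> nat \<Rightarrow> 'a \<Rightarrow> 'a" where
  "sweep_entry b y x a k d c t =
    (if d c \<le> a + Suc k
     then ypow b y (d (Suc c) - a) t * (1 + b * t) ^ Suc c * (\<Prod>l = d (Suc c) - a..<d c - a. fplus b x (y l))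
       - (1 + b * x) * (ypow b y (d c - a) t * (1 + b * t) ^ c)
     else (x - t) * (ypow b y (d c - Suc a) t * (1 + b * t) ^ c))"

text \<open>
  The value after the first \<open>k\<close> factors of a sweep. The particles \<open>0, \<dots>, m - 1\<close> have
  entered before, particle \<open>m\<close> enters at position \<open>a + 1\<close>, and the columns of the particles
  which the sweep has already passed have taken their final form.
\<close>

lemma partial_sweep:
  fixes b x V :: "'a :: comm_ring_1"
  assumes mn: "m < n" and a: "a = n - Suc m"
    and start: "\<And>d. positions N n d \<Longrightarrow> V * f (pos_perm (d ` {..<n})) =
      (if ground n m d then det (mat m m (\<lambda>(r, c). ypow b y (d c - Suc a) (t r) * (1 + b * t r) ^ c)) else 0)"
    and d: "positions N n d"
  shows "(\<Prod>r<m. x - t r) * V * fold (\<lambda>j. hop b (a + j) (fplus b x (y j))) [1..<Suc k] f (pos_perm (d ` {..<n})) =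
    (if ground n (Suc m) d \<and> d m \<le> a + Suc k
     then ypow b y (d m - a) x * det (mat m m (\<lambda>(r, c). sweep_entry b y x a k d c (t r))) else 0)"
  using d
proof (induction k arbitrary: d)
  case (0 d)
  have dm: "Suc a \<le> d m"
    using positions_ge [OF 0 mn] mn a by simp
  \<comment> \<open>Site \<open>Suc a\<close> is the ground site of particle \<open>m\<close>, and
    by \<open>positions_ge\<close> the particle cannot stand further left.\<close>
  have iff: "ground n m d \<longleftrightarrow> ground n (Suc m) d \<and> d m \<le> a + Suc 0"
  proof -
    have "n - m = Suc a"
      using mn a by simp
    then have "ground n m d \<longleftrightarrow> ground n (Suc m) d \<and> d m = Suc a"
      unfolding ground_def using mn by (metis Suc_leD Suc_leI le_neq_implies_less order_refl)
    with dm show ?thesis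
      by auto
  qed
  show ?case
  proof (cases "ground n m d")
    case True
    then have m: "d m = Suc a"
      using iff dm by simp
    \<comment> \<open>Nothing has been passed yet, so every column is in the second branch and
      \<open>x - t r\<close> comes out of each row.\<close>
    have "det (mat m m (\<lambda>(r, c). sweep_entry b y x a 0 d c (t r)))
        = det (mat m m (\<lambda>(r, c). (x - t r) * (ypow b y (d c - Suc a) (t r) * (1 + b * t r) ^ c)))"
    proof (rule det_mat_cong)
      fix r c assume "r < m" "c < m"
      then have "d c > Suc a"
        using positions_less [OF 0 _ mn, of c] m by simp
      then show "sweep_entry b y x a 0 d c (t r) = (x - t r) * (ypow b y (d c - Suc a) (t r) * (1 + b * t r) ^ c)"
        by (simp add: sweep_entry_def)
    qed
    also have "\<dots> = (\<Prod>r<m. x - t r) * det (mat m m (\<lambda>(r, c). ypow b y (d c - Suc a) (t r) * (1 + b * t r) ^ c))"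
      by (rule det_mat_row_scale)
    finally show ?thesis
      using True iff m start [OF 0] by (simp add: mult.assoc)
  next
    case False
    then show ?thesis
      using iff start [OF 0] by (auto simp: mult.assoc)
  qed
next
  case (Suc k d)
  note d = Suc.prems
  define z where "z = fplus b x (y (Suc k))"
  define F where "F = fold (\<lambda>j. hop b (a + j) (fplus b x (y j))) [1..<Suc k] f"
  define C where "C = (\<Prod>r<m. x - t r) * V"
  define R where "R k d = (if ground n (Suc m) d \<and> d m \<le> a + Suc k
     then ypow b y (d m - a) x * det (mat m m (\<lambda>(r, c). sweep_entry b y x a k d c (t r))) else 0)" for k d
  have IH: "C * F (pos_perm (d ` {..<n})) = R k d" if "positions N n d" for d
    using Suc.IH [OF that] by (simp only: C_def F_def R_def)
  have fold: "fold (\<lambda>j. hop b (a + j) (fplus b x (y j))) [1..<Suc (Suc k)] f = hop b (a + Suc k) z F"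
    by (simp add: F_def z_def)
  have ground_gt: "a < d c" if "ground n (Suc m) d" "positions N n d" "c \<le> m" for c d
  proof -
    have "n - c \<le> d c"
      using positions_ge [OF that(2), of c] that(3) mn by simp
    then show ?thesis
      using a mn that(3) by linarith
  qed
  have ground_le: "d c \<le> a" if "ground n (Suc m) d" "m < c" "c < n" for c d
    using that a unfolding ground_def by (metis Suc_leI diff_le_mono2)
  have one: "1 \<le> a + Suc k"
    by simp
  note hop = hop_positions [OF d one]
  have "C * hop b (a + Suc k) z F (pos_perm (d ` {..<n})) = R (Suc k) d"
  proof (cases "Suc (a + Suc k) \<in> d ` {..<n}")
    case False
    have "R (Suc k) d = R k d"
    proof -
      have ne: "d c \<noteq> Suc (a + Suc k)" if "c \<le> m" for c
        using False that mn by (metis imageI le_less_trans lessThan_iff)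
      have "det (mat m m (\<lambda>(r, c). sweep_entry b y x a (Suc k) d c (t r)))
          = det (mat m m (\<lambda>(r, c). sweep_entry b y x a k d c (t r)))"
      proof (rule det_mat_cong)
        fix r c assume "c < m"
        then show "sweep_entry b y x a (Suc k) d c (t r) = sweep_entry b y x a k d c (t r)"
          using ne [of c] by (simp add: sweep_entry_def)
      qed
      moreover have "d m \<le> a + Suc (Suc k) \<longleftrightarrow> d m \<le> a + Suc k"
        using ne [of m] by auto
      ultimately show ?thesis
        by (simp only: R_def)
    qed
    then show ?thesis
      unfolding hop(1) [OF False] using IH [OF d] by (simp only:)
  next
    case True
    then obtain e where e: "e < n" "d e = Suc (a + Suc k)"
      by auto
    show ?thesis
    proof (cases "a + Suc k \<in> d ` {..<n}")
      case True
      then obtain e' where e': "e' < n" "d e' = a + Suc k"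
        by auto
      have "R (Suc k) d = R k d"
      proof (cases "ground n (Suc m) d")
        case g: True
        have "e < e'"
          using positions_less [OF d, of e' e] e e' by (cases e e' rule: linorder_cases) auto
        have "e' = Suc e"
        proof (rule ccontr)
          assume "e' \<noteq> Suc e"
          with \<open>e < e'\<close> have "Suc e < e'"
            by simp
          then show False
            using positions_less [OF d, of e "Suc e"] positions_less [OF d, of "Suc e" e'] e e' by simp
        qed
        have "e < m"
          using ground_le [OF g _ e'(1)] e'(2) \<open>e' = Suc e\<close> by fastforce
        have dm: "d m < Suc (a + Suc k)"
          using positions_less [OF d \<open>e < m\<close> mn] e by simp
        have "det (mat m m (\<lambda>(r, c). sweep_entry b y x a (Suc k) d c (t r)))
            = det (mat m m (\<lambda>(r, c). sweep_entry b y x a k d c (t r)))"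
        proof (rule det_mat_cong)
          fix r c assume "c < m"
          show "sweep_entry b y x a (Suc k) d c (t r) = sweep_entry b y x a k d c (t r)"
          proof (cases "c = e")
            \<comment> \<open>Particle \<open>e\<close> is blocked by its left neighbour: the value
              stays, yet the column switches branch. Both branches agree here because (1 + b t)(x
              \<oplus> y) - (1 + b x)(t \<oplus> y) = x - t.\<close>
            case True
            then show ?thesis
              using e e' \<open>e' = Suc e\<close>
              by (simp add: sweep_entry_def ypow_Suc fplus_def Suc_diff_le algebra_simps)
          next
            case False
            then have "d c \<noteq> d e"
              using positions_less [OF d, of c e] positions_less [OF d, of e c] e \<open>c < m\<close> mn
              by (cases c e rule: linorder_cases) auto
            then show ?thesis
              using e by (simp add: sweep_entry_def)
          qed
        qed
        then show ?thesis
          using dm by (simp add: R_def)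
      qed (simp add: R_def)
      then show ?thesis
        unfolding hop(2) [OF True] using IH [OF d] by (simp only:)
    next
      case False
      let ?d = "d(e := a + Suc k)"
      have d': "positions N n ?d"
        using positions_step(1) [OF d one False e] .
      have "C * hop b (a + Suc k) z F (pos_perm (d ` {..<n})) = (1 + b * z) * R k d + z * R k ?d"
        unfolding hop(3) [OF False e] IH [OF d, symmetric] IH [OF d', symmetric]
        by (simp only: distrib_left mult.left_commute)
      also have "\<dots> = R (Suc k) d"
      proof (cases "ground n (Suc m) d \<and> e \<le> m")
        case False
        have "\<not> ground n (Suc m) d"
          using False ground_le [of d e] e by auto
        moreover have "\<not> ground n (Suc m) ?d"
        proof
          assume g: "ground n (Suc m) ?d"
          show False
          proof (cases "e \<le> m")
            case True
            then have "ground n (Suc m) d"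
              using g unfolding ground_def by auto
            with False True show False
              by simp
          next
            case False
            then show False
              using ground_le [OF g, of e] e by simp
          qed
        qed
        ultimately show ?thesis
          by (simp add: R_def)
      next
        case True
        then have g: "ground n (Suc m) d" and em: "e \<le> m"
          by auto
        have g': "ground n (Suc m) ?d"
          using g em unfolding ground_def by auto
        show ?thesis
        proof (cases "e = m")
          \<comment> \<open>The newly released particle itself arrives. \<open>R k d\<close> is 0,
            as it stands one site beyond the reach of the first \<open>k\<close> factors, and
            \<open>z\<close> is the next factor of its \<open>ypow\<close>.\<close>
          case True
          have "det (mat m m (\<lambda>(r, c). sweep_entry b y x a (Suc k) d c (t r)))
              = det (mat m m (\<lambda>(r, c). sweep_entry b y x a k ?d c (t r)))"
          proof (rule det_mat_cong)
            fix r c assume "c < m"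
            then have "d c > Suc (a + Suc k)"
              using positions_less [OF d _ e(1), of c] True e by simp
            then show "sweep_entry b y x a (Suc k) d c (t r) = sweep_entry b y x a k ?d c (t r)"
              using \<open>c < m\<close> True by (simp add: sweep_entry_def)
          qed
          then show ?thesis
            using g g' True e by (simp add: R_def ypow_Suc z_def mult_ac del: fun_upd_apply)
              (simp add: mult_ac)
        next
          case False
          with em have em: "e < m"
            by simp
          have ne: "d c \<noteq> a + Suc k" if "c < n" for c
            using \<open>a + Suc k \<notin> d ` {..<n}\<close> that by (metis imageI lessThan_iff)
          have dm: "d m \<le> a + Suc k"
            using positions_less [OF d em mn] e by simp
          \<comment> \<open>Column \<open>e - 1\<close> would involve \<open>d e\<close> only in the
            first branch, which it has not reached; so the move touches column \<open>e\<close>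
            alone.\<close>
          have "det (mat m m (\<lambda>(r, c). sweep_entry b y x a (Suc k) d c (t r)))
              = (1 + b * z) * det (mat m m (\<lambda>(r, c). sweep_entry b y x a k d c (t r)))
                + z * det (mat m m (\<lambda>(r, c). sweep_entry b y x a k ?d c (t r)))"
          proof (rule det_mat_column_linear [OF em])
            fix r c assume c: "c < m" "c \<noteq> e"
            consider "c < e" | "e < c"
              using c by linarith
            then show "sweep_entry b y x a (Suc k) d c (t r) = sweep_entry b y x a k d c (t r) \<and>
                sweep_entry b y x a (Suc k) d c (t r) = sweep_entry b y x a k ?d c (t r)"
            proof cases
              case 1
              then show ?thesis
                using positions_less [OF d 1 e(1)] e by (simp add: sweep_entry_def)
            next
              case 2
              have "c < n"
                using c mn by simp
              then show ?thesis
                using positions_less [OF d 2] e 2 by (simp add: sweep_entry_def)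
            qed
          next
            fix r
            define q where "q = d (Suc e) - a"
            have "a < d (Suc e)" "d (Suc e) < d e"
              using ground_gt [OF g d, of "Suc e"] positions_less [OF d, of e "Suc e"] em mn by simp_all
            with ne [of "Suc e"] em mn e have q: "1 \<le> q" "q \<le> Suc k"
              by (auto simp: q_def)
            have P: "(\<Prod>l = q..<Suc (Suc k). fplus b x (y l)) = (\<Prod>l = q..<Suc k. fplus b x (y l)) * z"
              using q by (simp add: z_def)
            define p w where "p = (\<Prod>l = q..<Suc k. fplus b x (y l))" and "w = ypow b y (Suc k) (t r)"
            have 1: "sweep_entry b y x a (Suc k) d e (t r) = ypow b y q (t r) * (1 + b * t r) ^ Suc e * (p * z)
                - (1 + b * x) * (w * fplus b (t r) (y (Suc k)) * (1 + b * t r) ^ e)"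
              using e by (simp add: sweep_entry_def ypow_Suc P p_def w_def flip: q_def del: prod.op_ivl_Suc)
            have 2: "sweep_entry b y x a k d e (t r) = (x - t r) * (w * (1 + b * t r) ^ e)"
              using e by (simp add: sweep_entry_def w_def)
            have 3: "sweep_entry b y x a k ?d e (t r) = ypow b y q (t r) * (1 + b * t r) ^ Suc e * p
                - (1 + b * x) * (w * (1 + b * t r) ^ e)"
              by (simp add: sweep_entry_def p_def w_def flip: q_def del: prod.op_ivl_Suc)
            \<comment> \<open>With y = \<open>y (Suc k)\<close>: 1 + b z = (1 + b x)(1 + b y), and z
              - (t \<oplus> y) = (x - t)(1 + b y).\<close>
            have 4: "(1 + b * z) * (x - t r) = (1 + b * x) * (z - fplus b (t r) (y (Suc k)))"
              by (simp add: z_def fplus_def algebra_simps)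
            have "(1 + b * z) * ((x - t r) * (w * (1 + b * t r) ^ e))
                = (1 + b * x) * (z - fplus b (t r) (y (Suc k))) * (w * (1 + b * t r) ^ e)"
              by (simp only: mult.assoc [symmetric] 4)
            then show "sweep_entry b y x a (Suc k) d e (t r)
                = (1 + b * z) * sweep_entry b y x a k d e (t r) + z * sweep_entry b y x a k ?d e (t r)"
              unfolding 1 2 3 by (simp add: algebra_simps)
          qed
          then show ?thesis
            using g g' dm False by (simp add: R_def algebra_simps)
        qed
      qed
      finally show ?thesis .
    qed
  qed
  then show ?case
    unfolding fold C_def R_def .
qed

lemma ypow_split: "1 \<le> q \<Longrightarrow> q \<le> q' \<Longrightarrow> ypow b y q t * (\<Prod>l = q..<q'. fplus b t (y l)) = ypow b y q' t"
  unfolding ypow_def by (rule prod.atLeastLessThan_concat)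

text \<open>At the end of the row all columns are in the first branch, so the row elimination can be
  read backwards and returns a determinant with one more row, that of \<open>t 0\<close>. The powers
  of \<open>1 + b * t 0\<close> on both sides are cancelled, which needs \<open>nz\<close> and an
  integral domain.\<close>

lemma full_sweep:
  fixes b V :: "'a :: idom"
  assumes mn: "m < n" and a: "a = n - Suc m"
    and start: "\<And>d. positions N n d \<Longrightarrow> V * f (pos_perm (d ` {..<n})) =
      (if ground n m d then det (mat m m (\<lambda>(r, c). ypow b y (d c - Suc a) (t (Suc r)) * (1 + b * t (Suc r)) ^ c)) else 0)"
    and nz: "1 + b * t 0 \<noteq> 0"
    and d: "positions N n d"
  shows "(\<Prod>r<m. t 0 - t (Suc r)) * V * sweep N b y (Suc a) (t 0) f (pos_perm (d ` {..<n})) =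
    (if ground n (Suc m) d
     then det (mat (Suc m) (Suc m) (\<lambda>(r, c). ypow b y (d c - a) (t r) * (1 + b * t r) ^ c)) else 0)"
proof -
  define u where "u = 1 + b * t 0"
  define G where "G r c = ypow b y (d c - a) (t r) * (1 + b * t r) ^ c" for r c
  \<comment> \<open>The factors by which the first row's \<open>ypow\<close> at particle
    \<open>c\<close> exceeds that at particle \<open>Suc c\<close>.\<close>
  define Z where "Z c = (\<Prod>l = d (Suc c) - a..<d c - a. fplus b (t 0) (y l))" for c
  have "n \<le> N"
    using positions_ge [OF d, of 0] positions_bounds [OF d, of 0] mn by simp
  then have N: "N - Suc a + 1 = Suc (N - Suc a)" "a + Suc (N - Suc a) = N"
    using a mn by simp_all
  have "sweep N b y (Suc a) (t 0) f = fold (\<lambda>j. hop b (a + j) (fplus b (t 0) (y j))) [1..<Suc (N - Suc a)] f"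
    unfolding sweep_def N by simp
  then have eq: "(\<Prod>r<m. t 0 - t (Suc r)) * V * sweep N b y (Suc a) (t 0) f (pos_perm (d ` {..<n})) =
    (if ground n (Suc m) d \<and> d m \<le> N
     then ypow b y (d m - a) (t 0) * det (mat m m (\<lambda>(r, c). sweep_entry b y (t 0) a (N - Suc a) d c (t (Suc r)))) else 0)"
    using partial_sweep [OF mn a start d, of "t 0" "N - Suc a"] unfolding N(2) by (simp only:)
  show ?thesis
  proof (cases "ground n (Suc m) d")
    case True
    have bounds: "a < d c" "d c \<le> N" if "c \<le> m" for c
    proof -
      show "a < d c"
        using positions_ge [OF d, of c] that mn a by linarith
      show "d c \<le> N"
        using positions_bounds [OF d, of c] that mn by simp
    qed
    have "G 0 (Suc c) * Z c = u * G 0 c" if "c < m" for c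
    proof -
      have "ypow b y (d (Suc c) - a) (t 0) * Z c = ypow b y (d c - a) (t 0)"
        unfolding Z_def using bounds [of "Suc c"] bounds [of c] positions_less [OF d, of c "Suc c"] that mn
        by (intro ypow_split) auto
      then show ?thesis
        by (simp add: G_def u_def mult_ac)
    qed
    then have elim: "(- u) ^ m * det (mat (Suc m) (Suc m) (\<lambda>(r, c). G r c))
        = (- 1) ^ m * G 0 m * det (mat m m (\<lambda>(r, c). G (Suc r) (Suc c) * Z c - u * G (Suc r) c))"
      by (rule det_mat_eliminate_row)
    have "det (mat m m (\<lambda>(r, c). sweep_entry b y (t 0) a (N - Suc a) d c (t (Suc r))))
        = det (mat m m (\<lambda>(r, c). G (Suc r) (Suc c) * Z c - u * G (Suc r) c))"
    proof (rule det_mat_cong)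
      fix r c assume "c < m"
      then show "sweep_entry b y (t 0) a (N - Suc a) d c (t (Suc r)) = G (Suc r) (Suc c) * Z c - u * G (Suc r) c"
        unfolding sweep_entry_def N(2) using bounds(2) [of c] by (simp add: G_def Z_def u_def)
    qed
    moreover have "(- u) ^ m = (- 1) ^ m * u ^ m"
      by (rule power_minus)
    moreover have "G 0 m = ypow b y (d m - a) (t 0) * u ^ m"
      by (simp add: G_def u_def)
    ultimately have "((- 1) ^ m * u ^ m) * det (mat (Suc m) (Suc m) (\<lambda>(r, c). G r c))
        = ((- 1) ^ m * u ^ m) * (ypow b y (d m - a) (t 0)
          * det (mat m m (\<lambda>(r, c). sweep_entry b y (t 0) a (N - Suc a) d c (t (Suc r)))))"
      using elim by (simp only: mult_ac)
    then have "det (mat (Suc m) (Suc m) (\<lambda>(r, c). G r c)) = ypow b y (d m - a) (t 0)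
          * det (mat m m (\<lambda>(r, c). sweep_entry b y (t 0) a (N - Suc a) d c (t (Suc r))))"
      using nz by (simp add: u_def)
    then show ?thesis
      unfolding eq using True bounds(2) [of m] by (simp add: G_def)
  qed (simp add: eq)
qed

section \<open>The bialternant formula\<close>

text \<open>The Vandermonde product of the last \<open>m\<close> of the \<open>n\<close> variables,
  those whose rows have already acted.\<close>

definition vdm :: "(nat \<Rightarrow> 'a :: comm_ring_1) \<Rightarrow> nat \<Rightarrow> nat \<Rightarrow> 'a" where
  "vdm x n m = (\<Prod>(i, j)\<in>{(i, j). n - m < i \<and> i < j \<and> j \<le> n}. x i - x j)"

lemma vdm_0: "vdm x n 0 = 1"
proof -
  have "{(i, j). n - 0 < i \<and> i < j \<and> j \<le> n} = {}"
    by auto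
  then show ?thesis
    unfolding vdm_def by (simp only: prod.empty)
qed

lemma vdm_Suc:
  assumes "m < n"
  shows "vdm x n (Suc m) = (\<Prod>r<m. x (n - m) - x (n - m + Suc r)) * vdm x n m"
proof -
  let ?P = "{(i, j). n - m < i \<and> i < j \<and> j \<le> n}"
  have *: "{(i, j). n - Suc m < i \<and> i < j \<and> j \<le> n} = (\<lambda>r. (n - m, n - m + Suc r)) ` {..<m} \<union> ?P"
  proof (intro equalityI subsetI)
    fix z assume "z \<in> {(i, j). n - Suc m < i \<and> i < j \<and> j \<le> n}"
    then obtain i j where z: "z = (i, j)" "n - Suc m < i" "i < j" "j \<le> n"
      by auto
    show "z \<in> (\<lambda>r. (n - m, n - m + Suc r)) ` {..<m} \<union> ?P"
    proof (cases "i = n - m")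
      case True
      then have "z = (n - m, n - m + Suc (j - Suc i))" "j - Suc i < m"
        using z assms by auto
      then show ?thesis
        by blast
    next
      case False
      then show ?thesis
        using z by auto
    qed
  qed (use assms in auto)
  have fin: "finite ?P"
    by (rule finite_subset [of _ "{..n} \<times> {..n}"]) auto
  have "vdm x n (Suc m) = (\<Prod>(i, j)\<in>(\<lambda>r. (n - m, n - m + Suc r)) ` {..<m}. x i - x j) * vdm x n m"
    unfolding vdm_def * by (rule prod.union_disjoint) (use fin in auto)
  also have "(\<Prod>(i, j)\<in>(\<lambda>r. (n - m, n - m + Suc r)) ` {..<m}. x i - x j) = (\<Prod>r<m. x (n - m) - x (n - m + Suc r))"
    by (subst prod.reindex) (auto simp: inj_on_def)
  finally show ?thesis .
qed

section \<open>Induction over the rows, starting from the identity\<close>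

lemma pos_perm_ground:
  assumes "positions N n d"
  shows "pos_perm (d ` {..<n}) = id \<longleftrightarrow> ground n 0 d"
proof
  assume id: "pos_perm (d ` {..<n}) = id"
  have "d j = n - j" if "j < n" for j
    using pos_perm_decreasing [of n d j] assms that id by (simp add: positions_def)
  then show "ground n 0 d"
    by (simp add: ground_def)
next
  assume "ground n 0 d"
  then have g: "d j = n - j" if "j < n" for j
    using that by (simp add: ground_def)
  have S: "d ` {..<n} = {1..n}"
  proof (intro equalityI subsetI)
    fix k assume "k \<in> {1..n}"
    then have "k = d (n - k)" "n - k < n"
      using g [of "n - k"] by auto
    then show "k \<in> d ` {..<n}"
      by blast
  qed (use g in auto)
  show "pos_perm (d ` {..<n}) = id"
  proof (rule ext)
    fix k
    have "{s \<in> {1..n}. s \<le> k} = {1..k}" if "k \<le> n"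
      using that by auto
    moreover have "{s \<in> {1..n}. k < s} = {}" if "n < k"
      using that by auto
    ultimately show "pos_perm (d ` {..<n}) k = id k"
      unfolding S pos_perm_def lower_def upper_def
      by (cases "k = 0"; cases "k \<le> n") (simp_all del: One_nat_def Collect_empty_eq)
  qed
qed

text \<open>For \<open>i = N\<close> the row is empty; this case occurs in
  \<open>stage_formula\<close> when \<open>n = N\<close>.\<close>

lemma stage_Suc: "i \<le> N \<Longrightarrow> stage N b x y i = sweep N b y i (x i) (stage N b x y (Suc i))"
proof (cases "i = N")
  case True
  then show ?thesis
    by (simp add: stage_def sweep_def)
next
  case False
  then show "i \<le> N \<Longrightarrow> ?thesis"
    by (simp add: stage_def upt_conv_Cons)
qed

text \<open>Rows beyond \<open>n\<close> contain only factors with \<open>k > n\<close>. Such a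
  factor acts only on a configuration with a particle at \<open>Suc k\<close>, and neither this
  configuration nor the one before the move is the ground state.\<close>

lemma stage_initial:
  assumes d: "positions N n d"
  shows "stage N b x y (Suc n) (pos_perm (d ` {..<n})) = (if ground n 0 d then 1 else 0)"
proof -
  let ?I = "\<lambda>f. \<forall>d. positions N n d \<longrightarrow> f (pos_perm (d ` {..<n})) = (if ground n 0 d then 1 else 0)"
  have init: "?I (indic id)"
    using pos_perm_ground by (simp add: indic_def)
  have hop: "?I (hop b k t f)" if I: "?I f" and k: "n < k" for k t f
  proof (intro allI impI)
    fix d assume d: "positions N n d"
    have k1: "1 \<le> k"
      using k by simp
    consider "Suc k \<notin> d ` {..<n}" | "k \<in> d ` {..<n}" | c where "k \<notin> d ` {..<n}" "c < n" "d c = Suc k"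
      by (metis imageE lessThan_iff)
    then show "hop b k t f (pos_perm (d ` {..<n})) = (if ground n 0 d then 1 else 0)"
    proof cases
      case 1
      then show ?thesis
        using I d hop_positions(1) [OF d k1] by metis
    next
      case 2
      then show ?thesis
        using I d hop_positions(2) [OF d k1] by metis
    next
      case 3
      have "\<not> ground n 0 d" "\<not> ground n 0 (d(c := k))"
        using 3 k unfolding ground_def by (auto intro!: exI [of _ c])
      moreover have "positions N n (d(c := k))"
        by (rule positions_step(1) [OF d k1 3])
      ultimately have "f (pos_perm (d ` {..<n})) = 0" "f (pos_perm ((d(c := k)) ` {..<n})) = 0"
        using I d by metis+
      with 3 \<open>\<not> ground n 0 d\<close> show ?thesis
        unfolding hop_positions(3) [OF d k1 3] by (simp del: fun_upd_apply)
    qed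
  qed
  have sweep: "?I (sweep N b y i t f)" if "?I f" "n < i" for i t f
    unfolding sweep_def
  proof (rule fold_invariant [where Q = "\<lambda>j. 1 \<le> j" and P = ?I])
    show "1 \<le> j" if "j \<in> set [1..<N - i + 1]" for j
      using that by auto
    show "?I (hop b (i + j - 1) (fplus b t (y j)) f)" if "1 \<le> j" "?I f" for j f
      using that(1) \<open>n < i\<close> by (intro hop [OF that(2)]) simp
  qed (rule that(1))
  have fold: "?I (foldr (\<lambda>i. sweep N b y i (x i)) is g)" if "\<forall>i\<in>set is. n < i" "?I g" for "is" g
    using that
  proof (induction "is")
    case (Cons i "is")
    then show ?case
      using sweep [of "foldr (\<lambda>i. sweep N b y i (x i)) is g" i "x i"] by simp
  qed simp
  have "\<forall>i\<in>set [Suc n..<N]. n < i"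
    by auto
  from fold [OF this init] d show ?thesis
    unfolding stage_def by blast
qed

text \<open>Each row releases one particle and contributes the differences of its variable with the
  later ones, so the Vandermonde product builds up along with the determinant.\<close>

lemma stage_formula:
  fixes b :: "'a :: idom"
  assumes "m \<le> n" and nz: "\<And>i. 1 \<le> i \<Longrightarrow> i \<le> n \<Longrightarrow> 1 + b * x i \<noteq> 0" and "positions N n d"
  shows "vdm x n m * stage N b x y (Suc (n - m)) (pos_perm (d ` {..<n})) =
    (if ground n m d then det (mat m m (\<lambda>(r, c). ypow b y (d c - (n - m)) (x (n - m + Suc r))
      * (1 + b * x (n - m + Suc r)) ^ c)) else 0)"
  using assms(1,3)
proof (induction m arbitrary: d)
  case 0
  then show ?case
    using stage_initial [OF 0(2), of b x y] by (simp add: vdm_0)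
next
  case (Suc m)
  define a where "a = n - Suc m"
  have mn: "m < n"
    using Suc.prems by simp
  have a: "n - m = Suc a"
    using mn by (simp add: a_def)
  have "n \<le> N"
    using positions_ge [OF Suc.prems(2), of 0] positions_bounds [OF Suc.prems(2), of 0] mn by simp
  then have st: "stage N b x y (Suc a) = sweep N b y (Suc a) (x (Suc a)) (stage N b x y (Suc (n - m)))"
    unfolding a using a by (intro stage_Suc) simp
  have "(\<Prod>r<m. x (a + Suc 0) - x (a + Suc (Suc r))) * vdm x n m
      * sweep N b y (Suc a) (x (a + Suc 0)) (stage N b x y (Suc (n - m))) (pos_perm (d ` {..<n}))
    = (if ground n (Suc m) d then det (mat (Suc m) (Suc m)
        (\<lambda>(r, c). ypow b y (d c - a) (x (a + Suc r)) * (1 + b * x (a + Suc r)) ^ c)) else 0)"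
  proof (rule full_sweep [OF mn a_def])
    fix d assume "positions N n d"
    then show "vdm x n m * stage N b x y (Suc (n - m)) (pos_perm (d ` {..<n})) =
      (if ground n m d then det (mat m m (\<lambda>(r, c). ypow b y (d c - Suc a) (x (a + Suc (Suc r)))
        * (1 + b * x (a + Suc (Suc r))) ^ c)) else 0)"
      using Suc.IH [of d] mn by (simp add: a)
  next
    show "1 + b * x (a + Suc 0) \<noteq> 0"
      using nz [of "Suc a"] mn by (simp add: a_def)
  qed (rule Suc.prems(2))
  then show ?case
    unfolding a_def [symmetric] st vdm_Suc [OF mn] a by simp
qed

lemma double_groth_bialternant:
  fixes b :: "'a :: idom"
  assumes n: "1 \<le> n" and lam: "\<And>i j. 1 \<le> i \<Longrightarrow> i \<le> j \<Longrightarrow> j \<le> n \<Longrightarrow> lam j \<le> lam i" and N: "n + lam 1 \<le> N"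
    and nz: "\<And>i. 1 \<le> i \<Longrightarrow> i \<le> n \<Longrightarrow> 1 + b * x i \<noteq> 0"
  shows "(\<Prod>(i, j)\<in>{(i, j). 1 \<le> i \<and> i < j \<and> j \<le> n}. x i - x j) * double_groth N b x y (grassmannian N n lam)
    = det1 n (\<lambda>i j. (\<Prod>a = 1..lam j + n - j. x i + y a + b * x i * y a) * (1 + b * x i) ^ (j - 1))"
proof -
  define d where "d c = lam (c + 1) + n - c" for c
  note g = grassmannian_inverse [of n lam N, OF n lam N, folded d_def]
  have d: "positions N n d"
    using g(3,4) by (simp add: positions_def d_def [abs_def])
  have "vdm x n n * double_groth N b x y (grassmannian N n lam)
    = det (mat n n (\<lambda>(r, c). ypow b y (d c) (x (Suc r)) * (1 + b * x (Suc r)) ^ c))"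
    using stage_formula [OF order_refl nz d, where y = y] g(2)
    by (simp add: double_groth_eq_stage [OF g(1)] ground_def d_def [abs_def])
  also have "\<dots> = det1 n (\<lambda>i j. (\<Prod>a = 1..lam j + n - j. x i + y a + b * x i * y a) * (1 + b * x i) ^ (j - 1))"
    unfolding det1_def
  proof (rule det_mat_cong)
    fix r c assume "c < n"
    \<comment> \<open>The position of a particle is one more than the exponent \<lambda>_j + n - j,
      where j = c + 1.\<close>
    then have "{1..<d c} = {1..lam (c + 1) + n - (c + 1)}"
      by (auto simp: d_def)
    then show "ypow b y (d c) (x (Suc r)) * (1 + b * x (Suc r)) ^ c =
      (\<Prod>a = 1..lam (c + 1) + n - (c + 1). x (r + 1) + y a + b * x (r + 1) * y a) * (1 + b * x (r + 1)) ^ (c + 1 - 1)"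
      by (simp add: ypow_def fplus_def)
  qed
  also have "vdm x n n = (\<Prod>(i, j)\<in>{(i, j). 1 \<le> i \<and> i < j \<and> j \<le> n}. x i - x j)"
    by (simp add: vdm_def Suc_le_eq)
  finally show ?thesis .
qed

section \<open>The Jacobi-Trudi formula\<close>

lemma finite_multisets_size:
  assumes "finite I"
  shows "finite {M. set_mset M \<subseteq> I \<and> int (size M) = r}"
proof (rule finite_subset)
  show "{M. set_mset M \<subseteq> I \<and> int (size M) = r} \<subseteq> mset ` {xs. set xs \<subseteq> I \<and> length xs = nat r}"
  proof
    fix M assume M: "M \<in> {M. set_mset M \<subseteq> I \<and> int (size M) = r}"
    obtain xs where "mset xs = M"
      using ex_mset by blast
    with M show "M \<in> mset ` {xs. set xs \<subseteq> I \<and> length xs = nat r}"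
      by auto
  qed
  show "finite (mset ` {xs. set xs \<subseteq> I \<and> length xs = nat r})"
    using finite_lists_length_eq [OF assms] by simp
qed

text \<open>A multiset either avoids \<open>a\<close> or loses one copy of it. The identity holds
  for every integer \<open>r\<close>, so negative degrees need no separate treatment later.\<close>

lemma complete_hom_insert:
  assumes "finite I" "a \<notin> I"
  shows "complete_hom (insert a I) x r = complete_hom I x r + x a * complete_hom (insert a I) x (r - 1)"
proof -
  let ?S = "\<lambda>I r. {M. set_mset M \<subseteq> I \<and> int (size M) = r}"
  have split: "?S (insert a I) r = ?S I r \<union> add_mset a ` ?S (insert a I) (r - 1)"
  proof (intro equalityI subsetI)
    fix M assume M: "M \<in> ?S (insert a I) r"
    show "M \<in> ?S I r \<union> add_mset a ` ?S (insert a I) (r - 1)"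
    proof (cases "a \<in># M")
      case True
      then obtain M' where "M = add_mset a M'"
        by (metis insert_DiffM)
      then show ?thesis
        using M by auto
    next
      case False
      then show ?thesis
        using M by auto
    qed
  qed auto
  have "complete_hom (insert a I) x r = (\<Sum>M\<in>?S I r. \<Prod>i\<in>#M. x i)
      + (\<Sum>M\<in>add_mset a ` ?S (insert a I) (r - 1). \<Prod>i\<in>#M. x i)"
    unfolding complete_hom_def split
  proof (rule sum.union_disjoint)
    show "finite (?S I r)"
      by (rule finite_multisets_size [OF assms(1)])
    show "finite (add_mset a ` ?S (insert a I) (r - 1))"
      by (intro finite_imageI finite_multisets_size finite.insertI assms(1))
    have "a \<in># M" if "M \<in> add_mset a ` ?S (insert a I) (r - 1)" for M
      using that by (elim imageE) simp
    moreover have "a \<notin># M" if "M \<in> ?S I r" for M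
      using that assms(2) by blast
    ultimately show "?S I r \<inter> add_mset a ` ?S (insert a I) (r - 1) = {}"
      by blast
  qed
  also have "(\<Sum>M\<in>add_mset a ` ?S (insert a I) (r - 1). \<Prod>i\<in>#M. x i) = x a * complete_hom (insert a I) x (r - 1)"
    unfolding complete_hom_def sum_distrib_left
    by (rule sum.reindex_cong [of "add_mset a"]) (simp_all add: inj_on_def)
  finally show ?thesis
    unfolding complete_hom_def .
qed

lemma complete_hom_neg: "r < 0 \<Longrightarrow> complete_hom I x r = 0"
  by (simp add: complete_hom_def)

lemma complete_hom_empty: "complete_hom {} x r = (if r = 0 then 1 else 0)"
proof -
  have "{M :: nat multiset. set_mset M \<subseteq> {} \<and> int (size M) = r} = (if r = 0 then {{#}} else {})"
    by auto
  then show ?thesis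
    unfolding complete_hom_def by (simp only:) simp
qed

lemma complete_hom_0: "finite I \<Longrightarrow> complete_hom I x 0 = 1"
  by (induction I rule: finite_induct) (simp_all add: complete_hom_empty complete_hom_insert complete_hom_neg)

lemma complete_hom_singleton: "complete_hom {i} x (int r) = x i ^ r"
proof (induction r)
  case (Suc r)
  then show ?case
    using complete_hom_insert [of "{}" i x "int (Suc r)"] by (simp add: complete_hom_empty)
qed (simp add: complete_hom_0)

text \<open>
  Adjoining a variable \<open>a\<close> multiplies the generating function of the \<open>h\<^sub>r\<close> by
  $1/(1 - x_a t)$, so the coefficients of $\prod_{a \in J} (1 - x_a t)$ remove the variables in \<open>J\<close>.
\<close>

definition removal_poly :: "nat set \<Rightarrow> (nat \<Rightarrow> 'a :: comm_ring_1) \<Rightarrow> 'a poly" where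
  "removal_poly J x = (\<Prod>a\<in>J. [:1, - x a:])"

lemma degree_removal_poly: "finite J \<Longrightarrow> degree (removal_poly J x) \<le> card J"
proof (induction J rule: finite_induct)
  case (insert a J)
  have "degree (removal_poly (insert a J) x) \<le> degree [:1, - x a:] + degree (removal_poly J x)"
    unfolding removal_poly_def prod.insert [OF insert(1,2)] by (rule degree_mult_le)
  also have "\<dots> \<le> card (insert a J)"
    using insert by simp
  finally show ?case .
qed (simp add: removal_poly_def)

text \<open>One variable at a time: multiplying the generating function by 1 - x_a t undoes
  \<open>complete_hom_insert\<close>.\<close>

lemma complete_hom_remove:
  assumes "finite J" "finite I" "I \<inter> J = {}"
  shows "(\<Sum>m\<le>card J. coeff (removal_poly J x) m * complete_hom (I \<union> J) x (r - int m)) = complete_hom I x r"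
  using assms
proof (induction J rule: finite_induct)
  case (insert a J)
  let ?p = "removal_poly J x" and ?h = "\<lambda>r. complete_hom (insert a (I \<union> J)) x r"
  have p: "removal_poly (insert a J) x = [:1, - x a:] * ?p"
    using insert by (simp add: removal_poly_def)
  have coeff_p: "coeff (removal_poly (insert a J) x) m = coeff ?p m - (case m of 0 \<Rightarrow> 0 | Suc m \<Rightarrow> x a * coeff ?p m)" for m
    unfolding p by (cases m) simp_all
  \<comment> \<open>The degree bound makes the extra summand \<open>m = Suc (card J)\<close>
    harmless in the sum without the shift.\<close>
  have top: "coeff ?p (Suc (card J)) = 0"
    using degree_removal_poly [of J x] insert by (intro coeff_eq_0) simp
  have "(\<Sum>m\<le>card (insert a J). coeff (removal_poly (insert a J) x) m * ?h (r - int m))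
      = (\<Sum>m\<le>Suc (card J). coeff ?p m * ?h (r - int m))
        - (\<Sum>m\<le>Suc (card J). (case m of 0 \<Rightarrow> 0 | Suc m \<Rightarrow> x a * coeff ?p m) * ?h (r - int m))"
    using insert by (simp add: coeff_p left_diff_distrib sum_subtractf del: sum.atMost_Suc)
  also have "(\<Sum>m\<le>Suc (card J). coeff ?p m * ?h (r - int m)) = (\<Sum>m\<le>card J. coeff ?p m * ?h (r - int m))"
    by (simp add: top)
  also have "(\<Sum>m\<le>Suc (card J). (case m of 0 \<Rightarrow> 0 | Suc m \<Rightarrow> x a * coeff ?p m) * ?h (r - int m))
      = (\<Sum>m\<le>card J. x a * coeff ?p m * ?h (r - int (Suc m)))"
    by (subst sum.atMost_Suc_shift) simp
  also have "(\<Sum>m\<le>card J. coeff ?p m * ?h (r - int m)) - (\<Sum>m\<le>card J. x a * coeff ?p m * ?h (r - int (Suc m)))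
      = (\<Sum>m\<le>card J. coeff ?p m * complete_hom (I \<union> J) x (r - int m))"
    unfolding sum_subtractf [symmetric]
  proof (rule sum.cong [OF refl])
    fix m
    have "?h (r - int m) = complete_hom (I \<union> J) x (r - int m) + x a * ?h (r - int (Suc m))"
      using complete_hom_insert [of "I \<union> J" a x "r - int m"] insert by (simp add: algebra_simps)
    then show "coeff ?p m * ?h (r - int m) - x a * coeff ?p m * ?h (r - int (Suc m))
        = coeff ?p m * complete_hom (I \<union> J) x (r - int m)"
      by (simp add: algebra_simps)
  qed
  also have "\<dots> = complete_hom I x r"
    using insert by auto
  finally show ?case
    by simp
qed (simp add: removal_poly_def)

text \<open>Row elimination with \<open>u = 1\<close> and every \<open>Z c\<close> equal to the
  first variable; each remaining row then carries a difference with that variable as a common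
  factor.\<close>

lemma vandermonde_det: "m \<le> n \<Longrightarrow> det (mat m m (\<lambda>(r, c). x (n - m + Suc r) ^ (m - Suc c))) = vdm x n m"
proof (induction m)
  case 0
  then show ?case
    by (simp add: vdm_0)
next
  case (Suc m)
  define a where "a = n - Suc m"
  have a: "n - m = Suc a"
    using Suc.prems by (simp add: a_def)
  have "(- 1) ^ m * det (mat (Suc m) (Suc m) (\<lambda>(r, c). x (a + Suc r) ^ (Suc m - Suc c)))
    = (- 1) ^ m * x (a + Suc 0) ^ (Suc m - Suc m) * det (mat m m
        (\<lambda>(r, c). x (a + Suc (Suc r)) ^ (Suc m - Suc (Suc c)) * x (a + Suc 0) - 1 * x (a + Suc (Suc r)) ^ (Suc m - Suc c)))"
    by (rule det_mat_eliminate_row) (simp add: Suc_diff_Suc flip: power_Suc2)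
  also have "det (mat m m
        (\<lambda>(r, c). x (a + Suc (Suc r)) ^ (Suc m - Suc (Suc c)) * x (a + Suc 0) - 1 * x (a + Suc (Suc r)) ^ (Suc m - Suc c)))
      = det (mat m m (\<lambda>(r, c). (x (Suc a) - x (Suc a + Suc r)) * x (Suc a + Suc r) ^ (m - Suc c)))"
  proof (rule det_mat_cong)
    fix r c assume "c < m"
    then have "Suc m - Suc c = Suc (m - Suc c)"
      by simp
    then show "x (a + Suc (Suc r)) ^ (Suc m - Suc (Suc c)) * x (a + Suc 0) - 1 * x (a + Suc (Suc r)) ^ (Suc m - Suc c)
        = (x (Suc a) - x (Suc a + Suc r)) * x (Suc a + Suc r) ^ (m - Suc c)"
      by (simp add: algebra_simps)
  qed
  also have "\<dots> = (\<Prod>r<m. x (n - m) - x (n - m + Suc r)) * vdm x n m"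
    unfolding det_mat_row_scale using Suc by (simp add: a)
  also have "\<dots> = vdm x n (Suc m)"
    using Suc.prems by (simp add: vdm_Suc)
  finally have "(- 1) ^ m * ((- 1) ^ m * det (mat (Suc m) (Suc m) (\<lambda>(r, c). x (a + Suc r) ^ (Suc m - Suc c))))
      = (- 1) ^ m * ((- 1) ^ m * vdm x n (Suc m))"
    by (simp only: diff_self_eq_0 power_0 mult_1_right)
  then show ?case
    unfolding a_def by (simp add: mult.assoc [symmetric] flip: power_add mult_2)
qed

text \<open>Removing all variables but one leaves the complete homogeneous polynomial of a single
  variable, which is its power. The coefficients are listed in reverse so that the degree of h grows
  with the row index \<open>k\<close>, as in the Jacobi-Trudi matrix.\<close>

lemma complete_hom_matrix:
  assumes "r < n"
  shows "(\<Sum>k<n. coeff (removal_poly ({1..n} - {Suc r}) x) (n - Suc k)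
    * complete_hom {1..n} x (int e - int n + 1 + int k)) = x (Suc r) ^ e"
proof -
  let ?J = "{1..n} - {Suc r}"
  have J: "finite ?J" "{Suc r} \<inter> ?J = {}" "{Suc r} \<union> ?J = {1..n}" "Suc (card ?J) = n"
    using assms by auto
  have "(\<Sum>m\<le>card ?J. coeff (removal_poly ?J x) m * complete_hom {1..n} x (int e - int m)) = x (Suc r) ^ e"
    using complete_hom_remove [OF J(1) _ J(2), of x "int e"] J(3) by (simp add: complete_hom_singleton)
  also have "{..card ?J} = {..<n}"
    using J(4) by auto
  finally have "x (Suc r) ^ e = (\<Sum>m<n. coeff (removal_poly ?J x) m * complete_hom {1..n} x (int e - int m))"
    by simp
  also have "\<dots> = (\<Sum>k<n. coeff (removal_poly ?J x) (n - Suc k) * complete_hom {1..n} x (int e - int (n - Suc k)))"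
    by (rule sum.nat_diff_reindex [symmetric])
  also have "\<dots> = (\<Sum>k<n. coeff (removal_poly ?J x) (n - Suc k)
      * complete_hom {1..n} x (int e - int n + 1 + int k))"
    by (rule sum.cong) (simp_all add: of_nat_diff algebra_simps)
  finally show ?thesis ..
qed

text \<open>By linearity each h in the sum becomes a power of one variable, and the binomial
  coefficients then assemble to a power of 1 + \<beta> x.\<close>

lemma beta_complete_hom_matrix:
  assumes "r < n" "c < n"
  shows "(\<Sum>k<n. coeff (removal_poly ({1..n} - {Suc r}) x) (n - Suc k)
      * beta_complete_hom {1..n} b x (int (l + (k + 1))) (c + 1))
    = x (Suc r) ^ (l + n - (c + 1)) * (1 + b * x (Suc r)) ^ c"
proof -
  let ?A = "\<lambda>k. coeff (removal_poly ({1..n} - {Suc r}) x) (n - Suc k)"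
  have "(\<Sum>k<n. ?A k * beta_complete_hom {1..n} b x (int (l + (k + 1))) (c + 1))
    = (\<Sum>k<n. \<Sum>a = 0..c. of_nat (c choose a) * b ^ a *
        (?A k * complete_hom {1..n} x (int (l + (k + 1)) - int (c + 1) + int a)))"
    by (simp add: beta_complete_hom_def sum_distrib_left mult_ac)
  also have "\<dots> = (\<Sum>a = 0..c. of_nat (c choose a) * b ^ a *
        (\<Sum>k<n. ?A k * complete_hom {1..n} x (int (l + (k + 1)) - int (c + 1) + int a)))"
    by (subst sum.swap) (simp add: sum_distrib_left)
  also have "\<dots> = (\<Sum>a = 0..c. of_nat (c choose a) * b ^ a * x (Suc r) ^ (l + n - (c + 1) + a))"
  proof (rule sum.cong [OF refl])
    fix a
    have "int (l + (k + 1)) - int (c + 1) + int a = int (l + n - (c + 1) + a) - int n + 1 + int k" for k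
      using assms by (simp add: of_nat_diff)
    then show "of_nat (c choose a) * b ^ a *
        (\<Sum>k<n. ?A k * complete_hom {1..n} x (int (l + (k + 1)) - int (c + 1) + int a))
      = of_nat (c choose a) * b ^ a * x (Suc r) ^ (l + n - (c + 1) + a)"
      using complete_hom_matrix [OF assms(1), of x "l + n - (c + 1) + a"] by (simp only:)
  qed
  also have "\<dots> = x (Suc r) ^ (l + n - (c + 1)) * (\<Sum>a\<le>c. of_nat (c choose a) * (b * x (Suc r)) ^ a * 1 ^ (c - a))"
    by (simp add: sum_distrib_left power_add power_mult_distrib mult_ac atLeast0AtMost)
  also have "(\<Sum>a\<le>c. of_nat (c choose a) * (b * x (Suc r)) ^ a * 1 ^ (c - a)) = (1 + b * x (Suc r)) ^ c"
    by (simp only: binomial_ring [symmetric] add.commute)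
  finally show ?thesis .
qed

lemma removal_det:
  "det (mat n n (\<lambda>(r, k). coeff (removal_poly ({1..n} - {Suc r}) x) (n - Suc k)))
    * det1 n (\<lambda>i j. beta_complete_hom {1..n} b x (int (lam j + i)) j)
    = det1 n (\<lambda>i j. x i ^ (lam j + n - j) * (1 + b * x i) ^ (j - 1))"
proof -
  let ?A = "mat n n (\<lambda>(r, k). coeff (removal_poly ({1..n} - {Suc r}) x) (n - Suc k))"
  let ?H = "mat n n (\<lambda>(r, c). beta_complete_hom {1..n} b x (int (lam (c + 1) + (r + 1))) (c + 1))"
  have "?A * ?H = mat n n (\<lambda>(r, c). x (r + 1) ^ (lam (c + 1) + n - (c + 1)) * (1 + b * x (r + 1)) ^ (c + 1 - 1))"
  proof (rule eq_matI, goal_cases)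
    case (1 r c)
    then show ?case
      using beta_complete_hom_matrix [of r n c x b "lam (c + 1)"]
      by (simp add: scalar_prod_def atLeast0LessThan)
  qed simp_all
  moreover have "det (?A * ?H) = det ?A * det ?H"
    by (rule det_mult [of _ n]) simp_all
  ultimately show ?thesis
    by (simp only: det1_def)
qed

text \<open>The coefficient matrix depends on neither \<lambda> nor \<beta>, so its determinant can
  be read off from \<open>removal_det\<close> at \<lambda> = 0, \<beta> = 0. There the Jacobi-Trudi
  matrix has entries h_{i-j}, hence is lower unitriangular, and the bialternant is the Vandermonde
  determinant.\<close>

lemma removal_det_eq_vdm:
  "det (mat n n (\<lambda>(r, k). coeff (removal_poly ({1..n} - {Suc r}) x) (n - Suc k))) = vdm x n n"
proof -
  let ?H = "mat n n (\<lambda>(r, c). complete_hom {1..n} x (int r - int c))"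
  have entry: "beta_complete_hom {1..n} 0 x (int (0 + (r + 1))) (c + 1) = complete_hom {1..n} x (int r - int c)" for r c
  proof -
    have "beta_complete_hom {1..n} 0 x (int (0 + (r + 1))) (c + 1)
      = (\<Sum>a\<in>{0}. of_nat (c choose a) * complete_hom {1..n} x (int r - int c + int a) * 0 ^ a)"
      unfolding beta_complete_hom_def by (rule sum.mono_neutral_cong_right) (auto simp: power_0_left)
    then show ?thesis
      by simp
  qed
  have "det ?H = prod_list (diag_mat ?H)"
    by (rule det_lower_triangular [of n]) (simp_all add: complete_hom_neg)
  also have "\<dots> = 1"
    by (simp add: prod_list_diag_prod complete_hom_0)
  finally have "det1 n (\<lambda>i j. beta_complete_hom {1..n} 0 x (int (0 + i)) j) = 1"
    by (simp only: det1_def entry)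
  with removal_det [of n x 0 "\<lambda>_. 0"]
  have "det (mat n n (\<lambda>(r, k). coeff (removal_poly ({1..n} - {Suc r}) x) (n - Suc k)))
    = det1 n (\<lambda>i j. x i ^ (n - j))"
    by simp
  also have "\<dots> = vdm x n n"
    using vandermonde_det [of n n x] by (simp add: det1_def)
  finally show ?thesis .
qed

lemma jacobi_trudi_bialternant:
  "(\<Prod>(i, j)\<in>{(i, j). 1 \<le> i \<and> i < j \<and> j \<le> n}. x i - x j)
      * det1 n (\<lambda>i j. beta_complete_hom {1..n} b x (int (lam j + i)) j)
    = det1 n (\<lambda>i j. x i ^ (lam j + n - j) * (1 + b * x i) ^ (j - 1))"
proof -
  have "vdm x n n = (\<Prod>(i, j)\<in>{(i, j). 1 \<le> i \<and> i < j \<and> j \<le> n}. x i - x j)"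
    by (simp add: vdm_def Suc_le_eq)
  then show ?thesis
    using removal_det [of n x b lam] by (simp only: removal_det_eq_vdm)
qed

section \<open>The polynomial ring\<close>

lemma xv_diff_nonzero: "i \<noteq> j \<Longrightarrow> xv i - xv j \<noteq> 0"
proof
  assume "i \<noteq> j" "xv i - xv j = 0"
  then have "xv i = xv j"
    by simp
  then have "Poly_Mapping.lookup (xv i) (Poly_Mapping.single (XVar i) 1)
      = Poly_Mapping.lookup (xv j) (Poly_Mapping.single (XVar i) 1)"
    by simp
  moreover have "Poly_Mapping.single (XVar j) (1 :: nat) \<noteq> Poly_Mapping.single (XVar i) 1"
    using \<open>i \<noteq> j\<close> by (metis keys_single one_neq_zero singleton_inject var.inject(1))
  ultimately show False
    by (simp add: xv_def lookup_single when_def)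
qed

text \<open>The constant term is 1. This supplies the cancellation needed in
  \<open>full_sweep\<close>.\<close>

lemma one_plus_beta_xv_nonzero: "1 + beta * xv i \<noteq> 0"
proof
  assume "1 + beta * xv i = 0"
  then have "Poly_Mapping.lookup (1 + beta * xv i) 0 = 0"
    by simp
  moreover have "Poly_Mapping.single (XVar i) (1 :: nat) \<noteq> 0"
    by (metis keys_single keys_zero empty_not_insert one_neq_zero)
  then have "Poly_Mapping.lookup (beta * xv i) 0 = 0"
    by (simp add: beta_def xv_def mult_single lookup_single when_def)
  ultimately show False
    by (simp add: lookup_add)
qed

theorem theorem1p4:
  fixes n N :: nat and lam :: "nat \<Rightarrow> nat"
  assumes "1 \<le> n"
    and "\<And>i j. 1 \<le> i \<Longrightarrow> i \<le> j \<Longrightarrow> j \<le> n \<Longrightarrow> lam j \<le> lam i"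
    and "n + lam 1 \<le> N"
  shows
    "groth N beta xv (grassmannian N n lam)
       = det1 n (\<lambda>i j. beta_complete_hom {1..n} beta xv (int (lam j + i)) j)
     \<and>
     to_fract (groth N beta xv (grassmannian N n lam))
       = to_fract (det1 n (\<lambda>i j. xv i ^ (lam j + n - j) * (1 + beta * xv i) ^ (j - 1)))
         / to_fract (\<Prod>(i, j) \<in> {(i, j). 1 \<le> i \<and> i < j \<and> j \<le> n}. xv i - xv j)
     \<and>
     to_fract (double_groth N beta xv yv (grassmannian N n lam))
       = to_fract (det1 n (\<lambda>i j.
             (\<Prod>a = 1..lam j + n - j. xv i + yv a + beta * xv i * yv a)
             * (1 + beta * xv i) ^ (j - 1)))
         / to_fract (\<Prod>(i, j) \<in> {(i, j). 1 \<le> i \<and> i < j \<and> j \<le> n}. xv i - xv j)"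
proof -
  let ?V = "\<Prod>(i, j) \<in> {(i, j). 1 \<le> i \<and> i < j \<and> j \<le> n}. xv i - xv j"
  let ?D = "det1 n (\<lambda>i j. xv i ^ (lam j + n - j) * (1 + beta * xv i) ^ (j - 1))"
  let ?E = "det1 n (\<lambda>i j. (\<Prod>a = 1..lam j + n - j. xv i + yv a + beta * xv i * yv a)
    * (1 + beta * xv i) ^ (j - 1))"
  let ?g = "grassmannian N n lam"
  have "finite {(i, j). 1 \<le> i \<and> i < j \<and> j \<le> n}"
    by (rule finite_subset [of _ "{..n} \<times> {..n}"]) auto
  then have V: "?V \<noteq> 0"
    using xv_diff_nonzero by (auto simp: prod_zero_iff)
  note bialternant = double_groth_bialternant [of n lam N beta xv, OF assms one_plus_beta_xv_nonzero]
  have double: "?V * double_groth N beta xv yv ?g = ?E"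
    by (rule bialternant)
  have single: "?V * groth N beta xv ?g = ?D"
    using bialternant [of "\<lambda>_. 0"] by (simp add: groth_eq_double_groth)
  \<comment> \<open>Both sides equal the same bialternant, so the Vandermonde product can be
    cancelled before passing to fractions.\<close>
  have "?V * groth N beta xv ?g = ?V * det1 n (\<lambda>i j. beta_complete_hom {1..n} beta xv (int (lam j + i)) j)"
    unfolding single jacobi_trudi_bialternant ..
  then have "groth N beta xv ?g = det1 n (\<lambda>i j. beta_complete_hom {1..n} beta xv (int (lam j + i)) j)"
    using V by simp
  moreover have quotient: "to_fract g = to_fract D / to_fract ?V" if "?V * g = D" for g D
    using V by (simp add: that [symmetric])
  ultimately show ?thesis
    using quotient [OF single] quotient [OF double] by blast
qed

end
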